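(* Let $\Gamma=(X,\mathcal{R})$ be a non-bipartite distance-regular graph with diameter $D\ge3$ having classical parameters $(D,q,\alpha,\beta)$ with $q<-1$, and fix $x\in X$. Assume $\Gamma$ is not a near polygon. Then $\Gamma$ does not support a uniform structure with respect to $x$.
   Context: All graphs are finite, simple, connected and undirected, with distance $\partial$. For a fixed vertex $x$ of eccentricity $\varepsilon$: $V=\mathbb{C}^X$, $A$ the adjacency matrix, $E_i^*$ the diagonal $0/1$ matrix with $(y,y)$-entry $1$ iff $\partial(x,y)=i$; $L=\sum_{i=1}^{\varepsilon}E^*_{i-1}AE^*_i$, $R=\sum_{i=0}^{\varepsilon-1}E^*_{i+1}AE^*_i=L^\top$. $\Gamma_f$ is the graph on $X$ whose edges are the edges $yz$ of $\Gamma$ with $\partial(x,y)\ne\partial(x,z)$ (bipartite, with lowering/raising matrices $L,R$). A parameter matrix is a tridiagonal complex $U=(e_{ij})_{1\le i,j\le\varepsilon}$ with $e_{ii}=1$, with $e_{i,i-1}\neq0$ for all $2\le i\le\varepsilon$ or $e_{i-1,i}\ne0$ for all $2\le i\le\varepsilon$, and every principal submatrix $(e_{ij})_{s\le i,j\le t}$ nonsingular; $e_i^-=e_{i,i-1}$, $e_i^+=e_{i,i+1}$, $e_1^-=e_\varepsilon^+=0$. A bipartite graph admits a uniform structure w.r.t. $x$ if there exist such $U$ and $f\in\mathbb{C}^\varepsilon$ with $e_i^-RL^2+LRL+e_i^+L^2R=f_iL$ on $E_i^*V$ for all $1\le i\le\varepsilon$. A non-bipartite $\Gamma$ supports a uniform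 structure w.r.t. $x$ if $\Gamma_f$ admits one. Distance-regular: $p^h_{ij}=|\{w:\partial(y,w)=i,\partial(z,w)=j\}|$ depends only on $h=\partial(y,z),i,j$; $c_i=p^i_{1,i-1}$, $a_i=p^i_{1,i}$, $b_i=p^i_{1,i+1}$. Classical parameters $(D,q,\alpha,\beta)$: $c_i=[i](1+\alpha[i-1])$, $b_i=([D]-[i])(\beta-\alpha[i])$, $[j]=1+q+\dots+q^{j-1}$. A near polygon is a distance-regular graph with $a_i=a_1c_i$ for $1\le i\le D-1$ containing no induced $K_{1,1,2}$. *)

theory Defs
  imports "HOL-Analysis.Analysis" "Jordan_Normal_Form.Determinant"
begin

text \<open>
  The vertex set is the finite type \<open>'v\<close>; a graph is given by its symmetric, irreflexive
  adjacency relation \<open>E\<close>. Matrices with rows and columns indexed by the vertices have type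
  \<open>complex^'v^'v\<close>; only the parameter matrices, whose size is the eccentricity of a vertex,
  use explicit numeric indices.
\<close>

section \<open>Graphs\<close>

definition connected_simple_graph :: "('v::finite \<times> 'v) set \<Rightarrow> bool" where
  "connected_simple_graph E \<longleftrightarrow> sym E \<and> irrefl E \<and> (\<forall>y z. (y, z) \<in> E\<^sup>*)"

text \<open>\<open>E ^^ n\<close> relates the end points of walks of length \<open>n\<close>.\<close>

definition gdist :: "('v::finite \<times> 'v) set \<Rightarrow> 'v \<Rightarrow> 'v \<Rightarrow> nat" where
  "gdist E y z = (LEAST n. (y, z) \<in> E ^^ n)"

definition eccentricity :: "('v::finite \<times> 'v) set \<Rightarrow> 'v \<Rightarrow> nat" where
  "eccentricity E x = Max (range (gdist E x))"

definition gdiameter :: "('v::finite \<times> 'v) set \<Rightarrow> nat" where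
  "gdiameter E = Max (range (eccentricity E))"

definition bipartite :: "('v::finite \<times> 'v) set \<Rightarrow> bool" where
  "bipartite E \<longleftrightarrow> (\<exists>S. \<forall>(y, z) \<in> E. y \<in> S \<longleftrightarrow> z \<notin> S)"

section \<open>Distance-regular graphs\<close>

definition distance_regular :: "('v::finite \<times> 'v) set \<Rightarrow> bool" where
  "distance_regular E \<longleftrightarrow> connected_simple_graph E \<and>
     (\<forall>i j y z y' z'. gdist E y z = gdist E y' z' \<longrightarrow>
        card {w. gdist E y w = i \<and> gdist E z w = j} =
        card {w. gdist E y' w = i \<and> gdist E z' w = j})"

text \<open>Well defined if \<open>E\<close> is distance-regular and \<open>h \<le> gdiameter E\<close>.\<close>

definition intersection_number :: "('v::finite \<times> 'v) set \<Rightarrow> nat \<Rightarrow> nat \<Rightarrow> nat \<Rightarrow> nat" where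
  "intersection_number E h i j =
     (THE p. \<exists>y z. gdist E y z = h \<and> p = card {w. gdist E y w = i \<and> gdist E z w = j})"

text \<open>\<open>c_num E i\<close> is only meant for \<open>i \<ge> 1\<close>.\<close>

definition c_num :: "('v::finite \<times> 'v) set \<Rightarrow> nat \<Rightarrow> nat" where
  "c_num E i = intersection_number E i 1 (i - 1)"

definition a_num :: "('v::finite \<times> 'v) set \<Rightarrow> nat \<Rightarrow> nat" where
  "a_num E i = intersection_number E i 1 i"

definition b_num :: "('v::finite \<times> 'v) set \<Rightarrow> nat \<Rightarrow> nat" where
  "b_num E i = intersection_number E i 1 (i + 1)"

definition qbracket :: "real \<Rightarrow> nat \<Rightarrow> real" where
  "qbracket q j = (\<Sum>k<j. q ^ k)"

definition has_classical_parameters ::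
  "('v::finite \<times> 'v) set \<Rightarrow> nat \<Rightarrow> real \<Rightarrow> real \<Rightarrow> real \<Rightarrow> bool" where
  "has_classical_parameters E D q \<alpha> \<beta> \<longleftrightarrow>
     distance_regular E \<and> gdiameter E = D \<and>
     (\<forall>i. 1 \<le> i \<and> i \<le> D \<longrightarrow>
        real (c_num E i) = qbracket q i * (1 + \<alpha> * qbracket q (i - 1))) \<and>
     (\<forall>i<D. real (b_num E i) = (qbracket q D - qbracket q i) * (\<beta> - \<alpha> * qbracket q i))"

text \<open>The parts of \<open>K\<^sub>1\<^sub>,\<^sub>1\<^sub>,\<^sub>2\<close> are \<open>{u}\<close>, \<open>{v}\<close> and \<open>{y, z}\<close>.\<close>

definition has_induced_K112 :: "('v::finite \<times> 'v) set \<Rightarrow> bool" where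
  "has_induced_K112 E \<longleftrightarrow> (\<exists>u v y z. distinct [u, v, y, z] \<and>
     (u, v) \<in> E \<and> (u, y) \<in> E \<and> (u, z) \<in> E \<and> (v, y) \<in> E \<and> (v, z) \<in> E \<and> (y, z) \<notin> E)"

definition near_polygon :: "('v::finite \<times> 'v) set \<Rightarrow> bool" where
  "near_polygon E \<longleftrightarrow> distance_regular E \<and>
     (\<forall>i. 1 \<le> i \<and> i \<le> gdiameter E - 1 \<longrightarrow> a_num E i = a_num E 1 * c_num E i) \<and>
     \<not> has_induced_K112 E"

section \<open>Lowering and raising matrices\<close>

definition adj_matrix :: "('v::finite \<times> 'v) set \<Rightarrow> complex^'v^'v" where
  "adj_matrix E = (\<chi> y z. if (y, z) \<in> E then 1 else 0)"

definition dual_idem :: "('v::finite \<times> 'v) set \<Rightarrow> 'v \<Rightarrow> nat \<Rightarrow> complex^'v^'v" where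
  "dual_idem E x i = (\<chi> y z. if y = z \<and> gdist E x y = i then 1 else 0)"

definition lowering_matrix :: "('v::finite \<times> 'v) set \<Rightarrow> 'v \<Rightarrow> complex^'v^'v" where
  "lowering_matrix E x =
     (\<Sum>i = 1..eccentricity E x. dual_idem E x (i - 1) ** adj_matrix E ** dual_idem E x i)"

definition raising_matrix :: "('v::finite \<times> 'v) set \<Rightarrow> 'v \<Rightarrow> complex^'v^'v" where
  "raising_matrix E x =
     (\<Sum>i<eccentricity E x. dual_idem E x (i + 1) ** adj_matrix E ** dual_idem E x i)"

section \<open>Uniform structures\<close>

text \<open>
  A parameter matrix of size \<open>\<epsilon>\<close> is given by its entries \<open>e i j\<close> with \<open>1 \<le> i, j \<le> \<epsilon>\<close>;
  all other values of \<open>e\<close> are ignored.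
\<close>

definition principal_submatrix :: "(nat \<Rightarrow> nat \<Rightarrow> complex) \<Rightarrow> nat \<Rightarrow> nat \<Rightarrow> complex mat" where
  "principal_submatrix e s t =
     Matrix.mat (t + 1 - s) (t + 1 - s) (\<lambda>(i, j). e (s + i) (s + j))"

definition parameter_matrix :: "nat \<Rightarrow> (nat \<Rightarrow> nat \<Rightarrow> complex) \<Rightarrow> bool" where
  "parameter_matrix \<epsilon> e \<longleftrightarrow>
     (\<forall>i\<in>{1..\<epsilon>}. \<forall>j\<in>{1..\<epsilon>}. i + 1 < j \<or> j + 1 < i \<longrightarrow> e i j = 0) \<and>
     (\<forall>i\<in>{1..\<epsilon>}. e i i = 1) \<and>
     ((\<forall>i\<in>{2..\<epsilon>}. e i (i - 1) \<noteq> 0) \<or> (\<forall>i\<in>{2..\<epsilon>}. e (i - 1) i \<noteq> 0)) \<and>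
     (\<forall>s t. 1 \<le> s \<and> s \<le> t \<and> t \<le> \<epsilon> \<longrightarrow> Determinant.det (principal_submatrix e s t) \<noteq> 0)"

definition e_minus :: "(nat \<Rightarrow> nat \<Rightarrow> complex) \<Rightarrow> nat \<Rightarrow> complex" where
  "e_minus e i = (if i = 1 then 0 else e i (i - 1))"

definition e_plus :: "nat \<Rightarrow> (nat \<Rightarrow> nat \<Rightarrow> complex) \<Rightarrow> nat \<Rightarrow> complex" where
  "e_plus \<epsilon> e i = (if i = \<epsilon> then 0 else e i (i + 1))"

text \<open>Meaningful for bipartite \<open>E\<close>; bipartiteness is not built in.\<close>

definition admits_uniform_structure :: "('v::finite \<times> 'v) set \<Rightarrow> 'v \<Rightarrow> bool" where
  "admits_uniform_structure E x \<longleftrightarrow>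
     (let \<epsilon> = eccentricity E x; L = lowering_matrix E x; R = raising_matrix E x in
      \<exists>e f. parameter_matrix \<epsilon> e \<and>
        (\<forall>i\<in>{1..\<epsilon>}. \<forall>v\<in>range (\<lambda>w. dual_idem E x i *v w).
           e_minus e i *s ((R ** L ** L) *v v) + (L ** R ** L) *v v
             + e_plus \<epsilon> e i *s ((L ** L ** R) *v v) = f i *s (L *v v)))"

text \<open>The graph \<open>\<Gamma>\<^sub>f\<close>.\<close>

definition flattening :: "('v::finite \<times> 'v) set \<Rightarrow> 'v \<Rightarrow> ('v \<times> 'v) set" where
  "flattening E x = {(y, z) \<in> E. gdist E x y \<noteq> gdist E x z}"

text \<open>
  Meaningful for non-bipartite \<open>E\<close>. The distances, eccentricity and matrices that
  enter are those of \<open>flattening E x\<close>; by the lemmas below they agree with those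
  computed from \<open>E\<close>, and the flattening is again a connected simple graph and bipartite.
\<close>

definition supports_uniform_structure :: "('v::finite \<times> 'v) set \<Rightarrow> 'v \<Rightarrow> bool" where
  "supports_uniform_structure E x \<longleftrightarrow> admits_uniform_structure (flattening E x) x"

lemma gdist_walk:
  assumes "connected_simple_graph E"
  shows "(y, z) \<in> E ^^ gdist E y z"
proof -
  have "\<exists>n. (y, z) \<in> E ^^ n"
    using assms by (auto simp: connected_simple_graph_def rtrancl_power)
  then show ?thesis unfolding gdist_def by (rule LeastI_ex)
qed

lemma gdist_le: "(y, z) \<in> E ^^ n \<Longrightarrow> gdist E y z \<le> n"
  unfolding gdist_def by (rule Least_le)

lemma gdist_edge:
  assumes "connected_simple_graph E" "(y, z) \<in> E"
  shows "gdist E x z \<le> gdist E x y + 1"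
  using gdist_le[where n = "Suc (gdist E x y)" and y = x and z = z and E = E] gdist_walk[OF assms(1), of x y] assms(2) by auto

lemma flattening_walk:
  assumes "connected_simple_graph E"
  shows "(x, y) \<in> flattening E x ^^ gdist E x y"
proof (induction "gdist E x y" arbitrary: y)
  case 0
  then show ?case using gdist_walk[OF assms, of x y] by simp
next
  case (Suc n)
  note y = Suc(2)[symmetric]
  have "(x, y) \<in> E ^^ Suc n" using gdist_walk[OF assms, of x y] unfolding y .
  then obtain w where w: "(x, w) \<in> E ^^ n" "(w, y) \<in> E" by auto
  have d: "gdist E x w = n"
    using gdist_le[OF w(1)] gdist_edge[OF assms w(2), of x] y by linarith
  have "(w, y) \<in> flattening E x" using w(2) by (simp add: flattening_def d y)
  moreover have "(x, w) \<in> flattening E x ^^ n" using Suc(1)[of w] unfolding d by blast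
  ultimately show ?case unfolding y by auto
qed

lemma gdist_flattening:
  assumes "connected_simple_graph E"
  shows "gdist (flattening E x) x y = gdist E x y"
proof (rule antisym)
  show "gdist (flattening E x) x y \<le> gdist E x y"
    by (rule gdist_le[OF flattening_walk[OF assms]])
  have "(x, y) \<in> flattening E x ^^ gdist (flattening E x) x y"
    unfolding gdist_def[of "flattening E x"]
    using flattening_walk[OF assms] by (rule LeastI)
  moreover have "flattening E x ^^ n \<subseteq> E ^^ n" for n
    by (induction n) (auto simp: flattening_def)
  ultimately have "(x, y) \<in> E ^^ gdist (flattening E x) x y" by (rule rev_subsetD)
  then show "gdist E x y \<le> gdist (flattening E x) x y" by (rule gdist_le)
qed

lemma eccentricity_flattening:
  "connected_simple_graph E \<Longrightarrow> eccentricity (flattening E x) x = eccentricity E x"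
  by (simp add: eccentricity_def gdist_flattening cong: image_cong)

lemma connected_simple_graph_flattening:
  assumes "connected_simple_graph E"
  shows "connected_simple_graph (flattening E x)"
proof -
  let ?F = "flattening E x"
  have s: "sym ?F" and i: "irrefl ?F"
    using assms by (auto simp: connected_simple_graph_def flattening_def sym_def irrefl_def)
  have x: "(x, y) \<in> ?F\<^sup>*" for y
    by (rule relpow_imp_rtrancl[OF flattening_walk[OF assms]])
  have "(y, z) \<in> ?F\<^sup>*" for y z
    using symD[OF sym_rtrancl[OF s] x[of y]] x[of z] by (rule rtrancl_trans)
  with s i show ?thesis by (simp add: connected_simple_graph_def)
qed

lemma bipartite_flattening:
  assumes "connected_simple_graph E"
  shows "bipartite (flattening E x)"
proof -
  have "even (gdist E x y) \<longleftrightarrow> odd (gdist E x z)" if "(y, z) \<in> flattening E x" for y z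
  proof -
    have e: "(y, z) \<in> E" and ne: "gdist E x y \<noteq> gdist E x z"
      using that by (auto simp: flattening_def)
    have e': "(z, y) \<in> E"
      using assms e by (simp add: connected_simple_graph_def symD)
    from gdist_edge[OF assms e, of x] gdist_edge[OF assms e', of x] ne
    consider "gdist E x z = gdist E x y + 1" | "gdist E x y = gdist E x z + 1" by linarith
    then show ?thesis by cases simp_all
  qed
  then show ?thesis
    unfolding bipartite_def by (intro exI[of _ "{y. even (gdist E x y)}"]) auto
qed

lemma dual_idem_sandwich:
  "(dual_idem E x i ** M ** dual_idem E x j) $ y $ z =
     (if gdist E x y = i \<and> gdist E x z = j then M $ y $ z else 0)"
proof -
  have r: "dual_idem E x j $ k $ z = (if k = z \<and> gdist E x k = j then 1 else 0)" for k
    by (simp add: dual_idem_def)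
  have l: "(dual_idem E x i ** M) $ y $ w = (if gdist E x y = i then M $ y $ w else 0)" for w
  proof -
    have "(dual_idem E x i ** M) $ y $ w =
        (\<Sum>k\<in>UNIV. if k = y then (if gdist E x y = i then M $ y $ w else 0) else 0)"
      by (simp only: matrix_matrix_mult_def dual_idem_def vec_lambda_beta, rule sum.cong, auto)
    then show ?thesis by simp
  qed
  have "(dual_idem E x i ** M ** dual_idem E x j) $ y $ z =
      (\<Sum>k\<in>UNIV. (dual_idem E x i ** M) $ y $ k * dual_idem E x j $ k $ z)"
    by (simp only: matrix_matrix_mult_def[of "dual_idem E x i ** M"] vec_lambda_beta)
  also have "\<dots> = (\<Sum>k\<in>UNIV. if k = z then (if gdist E x y = i \<and> gdist E x z = j
      then M $ y $ z else 0) else 0)"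
    by (rule sum.cong) (auto simp: l r)
  finally show ?thesis by simp
qed

lemma dual_idem_flattening:
  assumes "connected_simple_graph E"
  shows "dual_idem (flattening E x) x = dual_idem E x"
  by (simp add: fun_eq_iff dual_idem_def gdist_flattening[OF assms])

lemma sandwich_flattening:
  assumes "i \<noteq> j"
  shows "dual_idem E x i ** adj_matrix (flattening E x) ** dual_idem E x j =
    dual_idem E x i ** adj_matrix E ** dual_idem E x j"
  unfolding Finite_Cartesian_Product.vec_eq_iff dual_idem_sandwich
  using assms by (auto simp: adj_matrix_def flattening_def)

lemma lowering_matrix_flattening:
  assumes "connected_simple_graph E"
  shows "lowering_matrix (flattening E x) x = lowering_matrix E x"
  unfolding lowering_matrix_def dual_idem_flattening[OF assms] eccentricity_flattening[OF assms]
  by (rule sum.cong) (auto intro!: sandwich_flattening)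

lemma raising_matrix_flattening:
  assumes "connected_simple_graph E"
  shows "raising_matrix (flattening E x) x = raising_matrix E x"
  unfolding raising_matrix_def dual_idem_flattening[OF assms] eccentricity_flattening[OF assms]
  by (rule sum.cong) (auto intro!: sandwich_flattening)

end

theory Submission
  imports Defs
begin

text \<open>
  Let \<open>\<theta>\<^sub>0, \<theta>\<^sub>1, \<dots>\<close> be the sequence with \<open>\<theta>\<^sub>i - \<theta>\<^sub>i\<^sub>+\<^sub>1 = q\<^sup>-\<^sup>i\<close> that solves the
  three-term recurrence of the intersection numbers for the eigenvalue \<open>b\<^sub>1 / q - 1\<close>. The Gram
  matrix of the vectors \<open>(\<theta>\<^bsub>\<partial>(y,u)\<^esub>)\<^sub>y\<close> is a multiple of \<open>(\<theta>\<^bsub>\<partial>(u,v)\<^esub>)\<close>. Hence the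
  sum over all \<open>y\<close> of the squared entries of the defect \<open>W\<^sub>y\<close> in a cubic relation between
  \<open>A\<close> and \<open>F\<^sub>y = diag(\<theta>\<^bsub>\<partial>(y,\<cdot>)\<^esub>)\<close> is a combination of the diagonal entries
  \<open>(A\<^sup>i W\<^sub>s A\<^sup>j)\<^sub>s\<^sub>s\<close>; these only involve intersection numbers and vanish, so \<open>W\<^sub>y = 0\<close>.

  For adjacent \<open>x, y\<close> both at distance 2 from \<open>w\<close>, the \<open>(x,w)\<close>-entry of \<open>W\<^sub>y = 0\<close> says that
  the number of neighbours of \<open>w\<close> at distances 2, 3 from \<open>x, y\<close> is \<open>q\<close> times the number of
  common neighbours of \<open>x, y\<close> at distance 3 from \<open>w\<close>. As \<open>q < 0\<close>, both are zero, and in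
  particular there is no induced \<open>K\<^sub>1\<^sub>,\<^sub>1\<^sub>,\<^sub>2\<close>.

  Then all entries of the uniform relations at levels 1 and 2 are explicit. Not being a near polygon
  means \<open>a\<^sub>2 \<noteq> a\<^sub>1 c\<^sub>2\<close>, which provides a pair \<open>y, w\<close> at distance 2 without a common neighbour
  adjacent to \<open>x\<close>; this forces \<open>e\<^sub>2\<^sup>- = 1 - c\<^sub>2\<close> and \<open>e\<^sub>2\<^sup>+ = 0\<close>. If \<open>a\<^sub>1 > 0\<close>, a pair with
  one such neighbour gives \<open>c\<^sub>2 = 1\<close>, so \<open>e\<^sub>2\<^sup>- = 0\<close>, a contradiction. If \<open>a\<^sub>1 = 0\<close>, the relation
  at level 3 and its transpose, with \<open>e\<^sub>3\<^sup>- \<noteq> 0\<close>, give \<open>R L\<^sup>2 R\<^sup>2 = L R\<^sup>2 L R\<close> on level 1; its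
  entries at distances 2 and 3 are incompatible.
\<close>

section \<open>Distance-regular graphs\<close>

lemma relpow_sym:
  assumes "sym E" "(y, z) \<in> E ^^ n"
  shows "(z, y) \<in> E ^^ n"
  using assms(2)
proof (induction n arbitrary: z)
  case (Suc n)
  then obtain w where "(y, w) \<in> E ^^ n" "(w, z) \<in> E" by auto
  then have "(z, w) \<in> E" "(w, y) \<in> E ^^ n"
    using Suc.IH assms(1) by (auto dest: symD)
  then show ?case by (rule relpow_Suc_I2)
qed simp

locale distance_regular_graph =
  fixes E :: "('v::finite \<times> 'v) set"
  assumes drg: "distance_regular E"
begin

abbreviation d where "d \<equiv> gdist E"
abbreviation c where "c i \<equiv> real (c_num E i)"
abbreviation a where "a i \<equiv> real (a_num E i)"
abbreviation b where "b i \<equiv> real (b_num E i)"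

lemma conn: "connected_simple_graph E"
  using drg by (simp add: distance_regular_def)

lemma sym_E: "sym E"
  using conn by (simp add: connected_simple_graph_def)

lemma gdist_sym: "d y z = d z y"
  by (rule antisym; rule gdist_le; rule relpow_sym[OF sym_E]; rule gdist_walk[OF conn])

lemma gdist_triangle: "d y z \<le> d y w + d w z"
proof (rule gdist_le)
  show "(y, z) \<in> E ^^ (d y w + d w z)"
    unfolding relpow_add by (rule relcompI[where b = w]) (rule gdist_walk[OF conn])+
qed

lemma gdist_eq_0 [simp]: "d y z = 0 \<longleftrightarrow> y = z"
  using gdist_walk[OF conn, of y z] gdist_le[of y z 0 E] by auto

lemma gdist_self [simp]: "d y y = 0"
  by simp

lemma gdist_eq_1: "d y z = 1 \<longleftrightarrow> (y, z) \<in> E"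
proof
  show "d y z = 1 \<Longrightarrow> (y, z) \<in> E"
    using gdist_walk[OF conn, of y z] by simp
next
  assume e: "(y, z) \<in> E"
  have "y \<noteq> z"
    using e conn by (auto simp: connected_simple_graph_def irrefl_def)
  then have "d y z \<noteq> 0" by simp
  moreover have "d y z \<le> 1"
    using e gdist_le[of y z 1 E] by simp
  ultimately show "d y z = 1" by linarith
qed

lemma gdist_between:
  assumes "i \<le> d y z"
  obtains w where "d y w = i" "d w z = d y z - i"
proof -
  have "(y, z) \<in> E ^^ i O E ^^ (d y z - i)"
    using gdist_walk[OF conn, of y z] assms by (simp flip: relpow_add)
  then obtain w where "(y, w) \<in> E ^^ i" "(w, z) \<in> E ^^ (d y z - i)" by auto
  then have "d y w \<le> i" "d w z \<le> d y z - i" by (auto intro: gdist_le)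
  with gdist_triangle[of y z w] assms have "d y w = i" "d w z = d y z - i" by auto
  then show ?thesis by (rule that)
qed

section \<open>Intersection numbers as counts at arbitrary pairs of vertices\<close>

lemma intersection_number:
  "card {w. d y w = i \<and> d z w = j} = intersection_number E (d y z) i j"
proof -
  have *: "card {w. d y' w = i \<and> d z' w = j} = card {w. d y w = i \<and> d z w = j}"
    if "d y' z' = d y z" for y' z'
    using drg that unfolding distance_regular_def by blast
  show ?thesis
    unfolding intersection_number_def
  proof (rule the_equality[symmetric])
    show "\<exists>y' z'. d y' z' = d y z \<and>
        card {w. d y w = i \<and> d z w = j} = card {w. d y' w = i \<and> d z' w = j}"
      by blast
  next
    fix p
    assume "\<exists>y' z'. d y' z' = d y z \<and> p = card {w. d y' w = i \<and> d z' w = j}"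
    then show "p = card {w. d y w = i \<and> d z w = j}"
      using * by blast
  qed
qed

lemma gdist_le_diameter: "d y z \<le> gdiameter E"
proof -
  have "d y z \<le> eccentricity E y" by (simp add: eccentricity_def)
  also have "\<dots> \<le> gdiameter E" by (simp add: gdiameter_def)
  finally show ?thesis .
qed

text \<open>A geodesic of maximal length gives one vertex with a nonempty sphere of radius
  \<open>i\<close>; sphere sizes agree at all vertices, so every \<open>y\<close> has one.\<close>

lemma ex_gdist:
  assumes "i \<le> gdiameter E"
  obtains z where "d y z = i"
proof -
  have "gdiameter E \<in> range (eccentricity E)"
    unfolding gdiameter_def by (rule Max_in) auto
  then obtain u where u: "gdiameter E = eccentricity E u" by auto
  have "eccentricity E u \<in> range (d u)"
    unfolding eccentricity_def by (rule Max_in) auto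
  then obtain v where "d u v = gdiameter E" using u by auto
  then obtain w where w: "d u w = i" using gdist_between[of i u v] assms by auto
  have "card {z. d y z = i \<and> d y z = i} = card {z. d u z = i \<and> d u z = i}"
    by (simp only: intersection_number gdist_self)
  moreover have "card {z. d u z = i \<and> d u z = i} > 0"
    using w by (auto simp: card_gt_0_iff)
  ultimately have "card {z. d y z = i \<and> d y z = i} > 0" by linarith
  then show ?thesis using that unfolding card_gt_0_iff by blast
qed

lemma eccentricity_eq: "eccentricity E x = gdiameter E"
proof (rule antisym)
  show "eccentricity E x \<le> gdiameter E" by (simp add: gdiameter_def)
  obtain z where "d x z = gdiameter E" using ex_gdist[OF order_refl] .
  moreover have "d x z \<le> eccentricity E x"
    unfolding eccentricity_def by (rule Max_ge) simp_all
  ultimately show "gdiameter E \<le> eccentricity E x" by simp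
qed

lemma card_c: "d y z = i \<Longrightarrow> card {w. d y w = 1 \<and> d z w = i - 1} = c_num E i"
  by (simp only: intersection_number c_num_def)

lemma card_a: "d y z = i \<Longrightarrow> card {w. d y w = 1 \<and> d z w = i} = a_num E i"
  by (simp only: intersection_number a_num_def)

lemma card_b: "d y z = i \<Longrightarrow> card {w. d y w = 1 \<and> d z w = i + 1} = b_num E i"
  by (simp only: intersection_number b_num_def)

text \<open>Some pair at distance \<open>i\<close> extends along a geodesic, and the number of
  extensions is the same for all pairs at that distance.\<close>

lemma ex_raise:
  assumes "d y z = i" "i < gdiameter E"
  obtains w where "d y w = 1" "d z w = i + 1"
proof -
  obtain u where u: "d y u = i + 1" using ex_gdist[of "i + 1" y] assms(2) by auto
  obtain v where v: "d y v = i" "d v u = 1" using gdist_between[of i y u] u by auto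
  have "card {w. d v w = 1 \<and> d y w = i + 1} = b_num E i"
    using v by (intro card_b) (simp add: gdist_sym[of v y])
  moreover have "card {w. d v w = 1 \<and> d y w = i + 1} > 0"
    using u v by (auto simp: card_gt_0_iff)
  ultimately have "card {w. d y w = 1 \<and> d z w = i + 1} > 0"
    using card_b[OF assms(1)] by simp
  then have "{w. d y w = 1 \<and> d z w = i + 1} \<noteq> {}" by (simp only: card_gt_0_iff finite simp_thms)
  then obtain w where "d y w = 1" "d z w = i + 1" by blast
  then show ?thesis by (rule that)
qed

lemma b_pos: "i < gdiameter E \<Longrightarrow> b_num E i > 0"
proof -
  assume i: "i < gdiameter E"
  obtain y where "y \<in> (UNIV :: 'v set)" by simp
  obtain z where z: "d y z = i" using ex_gdist[of i y] i by auto
  obtain w where "d y w = 1" "d z w = i + 1" using ex_raise[OF z i] .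
  then have "{w. d y w = 1 \<and> d z w = i + 1} \<noteq> {}" by auto
  then have "card {w. d y w = 1 \<and> d z w = i + 1} > 0" by (simp only: card_gt_0_iff finite simp_thms)
  then show ?thesis using card_b[OF z] by simp
qed

lemma c_pos:
  assumes "1 \<le> i" "i \<le> gdiameter E"
  shows "c_num E i > 0"
proof -
  obtain y where "y \<in> (UNIV :: 'v set)" by simp
  obtain z where z: "d y z = i" using ex_gdist[of i y] assms by auto
  obtain w where "d y w = 1" "d w z = d y z - 1" using gdist_between[of 1 y z] z assms by auto
  then have "d y w = 1" "d z w = i - 1" using z gdist_sym[of z w] by auto
  then have "{w. d y w = 1 \<and> d z w = i - 1} \<noteq> {}" by blast
  then have "card {w. d y w = 1 \<and> d z w = i - 1} > 0" by (simp only: card_gt_0_iff finite simp_thms)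
  then show ?thesis using card_c[OF z] by simp
qed

lemma c_0: "c_num E 0 = 0" and a_0: "a_num E 0 = 0"
proof -
  obtain y where "y \<in> (UNIV :: 'v set)" by simp
  have "{w. d y w = 1 \<and> d y w = 0} = {}" by auto
  then show "c_num E 0 = 0" "a_num E 0 = 0"
    using card_c[of y y 0] card_a[of y y 0] by (simp_all only: card.empty gdist_self diff_0_eq_0)
qed

lemma c_1: "1 \<le> gdiameter E \<Longrightarrow> c_num E 1 = 1"
proof -
  assume *: "1 \<le> gdiameter E"
  obtain y where "y \<in> (UNIV :: 'v set)" by simp
  obtain z where z: "d y z = 1" using ex_gdist[OF *] .
  have "{w. d y w = 1 \<and> d z w = 1 - 1} = {z}" using z by auto
  then show ?thesis using card_c[OF z] by simp
qed

text \<open>The tridiagonal intersection matrix, that is, the adjacency matrix acting on functions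
  of the distance from a base vertex. The truncated \<open>f (i - 1)\<close> at \<open>i = 0\<close>
  is harmless because \<open>c 0 = 0\<close>.\<close>

definition T :: "(nat \<Rightarrow> real) \<Rightarrow> nat \<Rightarrow> real" where
  "T f i = c i * f (i - 1) + a i * f i + b i * f (i + 1)"

lemma sum_neighbours:
  fixes f :: "nat \<Rightarrow> real"
  shows "(\<Sum>w | d v w = 1. f (d s w)) = T f (d s v)"
proof -
  define i where "i = d s v"
  have i: "d v s = i" by (simp add: i_def gdist_sym)
  have cases: "d s w = i - 1 \<or> d s w = i \<or> d s w = i + 1" if "d v w = 1" for w
    using that gdist_triangle[of s w v] gdist_triangle[of s v w] i gdist_sym[of v w] gdist_sym[of v s]
    by linarith
  have split: "(\<Sum>w | d v w = 1. f (d s w)) = 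
      (\<Sum>w | d v w = 1. (if d s w = i - 1 then f (i - 1) else 0) + (if d s w = i then f i else 0) +
         (if d s w = i + 1 then f (i + 1) else 0))"
  proof (rule sum.cong)
    fix w assume w: "w \<in> {w. d v w = 1}"
    then have "i = 0 \<Longrightarrow> d s w = 1" using i by auto
    then show "f (d s w) = (if d s w = i - 1 then f (i - 1) else 0) + (if d s w = i then f i else 0) +
         (if d s w = i + 1 then f (i + 1) else 0)"
      using cases[of w] w by (cases "i = 0") auto
  qed simp
  have *: "(\<Sum>w | d v w = 1. (if d s w = j then f j else 0)) = card {w. d v w = 1 \<and> d s w = j} * f j" for j
  proof -
    have "(\<Sum>w | d v w = 1. (if d s w = j then f j else 0)) = (\<Sum>w\<in>{w \<in> {w. d v w = 1}. d s w = j}. f j)"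
      by (rule sum.inter_filter[symmetric]) simp
    then show ?thesis by simp
  qed
  show ?thesis
    unfolding split sum.distrib * T_def i_def[symmetric] card_a[OF i] card_b[OF i] card_c[OF i] ..
qed

lemma valency: "i \<le> gdiameter E \<Longrightarrow> c i + a i + b i = b 0"
proof -
  assume i: "i \<le> gdiameter E"
  obtain y where "y \<in> (UNIV :: 'v set)" by simp
  obtain z where z: "d y z = i" using ex_gdist[OF i] .
  have "card {w. d z w = 1} = T (\<lambda>_. 1) i" using sum_neighbours[where f = "\<lambda>_. 1" and v = z and s = y] z by simp
  moreover have "{w. d z w = 1} = {w. d z w = 1 \<and> d z w = 0 + 1}" by auto
  then have "card {w. d z w = 1} = b_num E 0" using card_b[of z z 0] by simp
  ultimately show ?thesis by (simp add: T_def)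
qed

end

section \<open>Classical parameters and the eigenvalue sequence\<close>

lemma qbracket_0 [simp]: "qbracket q 0 = 0"
  by (simp add: qbracket_def)

lemma qbracket_1 [simp]: "qbracket q (Suc 0) = 1"
  by (simp add: qbracket_def)

lemma qbracket_Suc': "qbracket q (Suc n) = qbracket q n + q ^ n"
  by (simp add: qbracket_def)

lemma qbracket_Suc: "qbracket q (Suc n) = 1 + q * qbracket q n"
  unfolding qbracket_def sum.lessThan_Suc_shift by (simp add: sum_distrib_left)

lemma qbracket_2: "qbracket q 2 = 1 + q"
  by (simp add: numeral_2_eq_2 qbracket_Suc)

lemma qbracket_3: "qbracket q 3 = 1 + q + q\<^sup>2"
  by (simp add: numeral_3_eq_3 qbracket_Suc algebra_simps power2_eq_square)

lemma power_eq_qbracket: "q ^ n = 1 + (q - 1) * qbracket q n"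
  using qbracket_Suc[of q n] qbracket_Suc'[of q n] by (simp add: algebra_simps)

lemma sum_inverse_powers: "q \<noteq> 0 \<Longrightarrow> q ^ n * (\<Sum>j<n. 1 / q ^ j) = q * qbracket q n"
proof (induction n)
  case (Suc n)
  have "q ^ Suc n * (\<Sum>j<Suc n. 1 / q ^ j) = q * (q ^ n * (\<Sum>j<n. 1 / q ^ j)) + q"
    using Suc.prems by (simp add: algebra_simps)
  then show ?case using Suc by (simp add: qbracket_Suc algebra_simps)
qed simp

locale classical_negative = distance_regular_graph E for E :: "('v::finite \<times> 'v) set" +
  fixes D :: nat and q \<alpha> \<beta> :: real
  assumes classical: "has_classical_parameters E D q \<alpha> \<beta>"
    and diameter_ge: "D \<ge> 3" and q_less: "q < -1"
begin

lemma diameter: "gdiameter E = D"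
  using classical by (simp add: has_classical_parameters_def)

abbreviation N where "N \<equiv> qbracket q D"

lemma c_eq: "i \<le> D \<Longrightarrow> c i = qbracket q i * (1 + \<alpha> * qbracket q (i - 1))"
  using classical c_0 by (cases "i = 0") (auto simp: has_classical_parameters_def)

lemma b_eq: "i \<le> D \<Longrightarrow> b i = (N - qbracket q i) * (\<beta> - \<alpha> * qbracket q i)"
proof (cases "i = D")
  \<comment> \<open>The hypothesis covers \<open>i < D\<close> only; at \<open>i = D\<close> the
    formula has the factor \<open>N - N\<close> and the count is empty.\<close>
  case True
  obtain y where "y \<in> (UNIV :: 'v set)" by simp
  obtain z where z: "d y z = D" using ex_gdist[of D y] diameter by auto
  have *: "{w. d y w = 1 \<and> d z w = D + 1} = {}"
    using gdist_le_diameter[of z] unfolding diameter by (metis (mono_tags, lifting) Collect_empty_eq Suc_eq_plus1 not_less_eq_eq order_refl)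
  have "b_num E D = 0" using card_b[OF z] unfolding * by simp
  then show ?thesis by (simp add: True)
next
  case False
  moreover assume "i \<le> D"
  ultimately show ?thesis using classical by (auto simp: has_classical_parameters_def)
qed

lemma a_eq: "i \<le> D \<Longrightarrow> a i = b 0 - b i - c i"
  using valency[of i] diameter by simp

lemma c1: "c 1 = 1"
  using c_1 diameter diameter_ge by simp

lemma params:
  "b 0 = N * \<beta>" "b 1 = (N - 1) * (\<beta> - \<alpha>)" "b 2 = (N - 1 - q) * (\<beta> - \<alpha> * (1 + q))"
  "c 2 = (1 + q) * (1 + \<alpha>)" "c 3 = (1 + q + q\<^sup>2) * (1 + \<alpha> * (1 + q))"
  "a 1 = N * \<alpha> + \<beta> - \<alpha> - 1"
  "a 2 = (1 + q) * (N * \<alpha> + \<beta> - \<alpha> * (1 + q) - 1 - \<alpha>)"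
proof -
  show *: "b 0 = N * \<beta>" "b 1 = (N - 1) * (\<beta> - \<alpha>)" "b 2 = (N - 1 - q) * (\<beta> - \<alpha> * (1 + q))"
    "c 2 = (1 + q) * (1 + \<alpha>)" "c 3 = (1 + q + q\<^sup>2) * (1 + \<alpha> * (1 + q))"
    using diameter_ge b_eq[of 0] b_eq[of 1] b_eq[of 2] c_eq[of 2] c_eq[of 3] qbracket_2[of q] qbracket_3[of q]
    by (simp_all add: diff_diff_eq[symmetric])
  have "a 1 = b 0 - b 1 - c 1" using a_eq[of 1] diameter_ge by simp
  then show "a 1 = N * \<alpha> + \<beta> - \<alpha> - 1"
    unfolding * c1 by (simp add: algebra_simps)
  have "a 2 = b 0 - b 2 - c 2" using a_eq[of 2] diameter_ge by simp
  then show "a 2 = (1 + q) * (N * \<alpha> + \<beta> - \<alpha> * (1 + q) - 1 - \<alpha>)"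
    unfolding * by (simp add: algebra_simps)
qed

section \<open>An eigenvalue and its recurrence sequence\<close>

definition eigenvalue :: real where "eigenvalue = b 1 / q - 1"

text \<open>Up to scaling, the cosine sequence of \<open>eigenvalue\<close>. The constant term is
  the value forced by the recurrence at 0,
  \<open>b 0 * (theta 0 - 1) = eigenvalue * theta 0\<close>.\<close>

definition theta :: "nat \<Rightarrow> real" where
  "theta i = b 0 / (b 0 - eigenvalue) - (\<Sum>j<i. 1 / q ^ j)"

lemma eigenvalue_less: "b 0 - eigenvalue > 0" "theta 0 > 0"
proof -
  have "b 1 / q \<le> 0" using q_less by (simp add: divide_nonneg_neg)
  then show *: "b 0 - eigenvalue > 0" unfolding eigenvalue_def by simp
  have "b 0 > 0" using b_pos[of 0] diameter diameter_ge by simp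
  with * show "theta 0 > 0" by (simp add: theta_def)
qed

lemma theta_Suc: "theta (Suc i) = theta i - 1 / q ^ i"
  by (simp add: theta_def)

text \<open>As \<open>a i = b 0 - b i - c i\<close>, only differences of \<open>theta\<close> remain
  after subtracting \<open>b 0 * theta i\<close>. Multiplied by
  \<open>q ^ i = 1 + (q - 1) * X\<close>, both sides become polynomials in the bracket
  \<open>X\<close>.\<close>

lemma T_theta:
  assumes "i \<le> D"
  shows "T theta i = eigenvalue * theta i"
proof -
  have q: "q \<noteq> 0" using q_less by simp
  define X where "X = qbracket q i"
  define Q where "Q = q ^ i"
  have Q: "Q \<noteq> 0" "Q = 1 + (q - 1) * X" using q by (simp_all add: Q_def X_def power_eq_qbracket[symmetric])
  have b0: "b 0 = N * \<beta>" and b: "b i = (N - X) * (\<beta> - \<alpha> * X)"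
    using b_eq[of 0] b_eq[OF assms] by (simp_all add: X_def)
  have cq: "c i * q = X * (q + \<alpha> * (X - 1))"
  proof (cases i)
    case (Suc n)
    have "q * qbracket q n = X - 1" using Suc by (simp add: X_def qbracket_Suc)
    have "c i * q = X * (q + \<alpha> * (q * qbracket q n))"
      unfolding c_eq[OF assms] by (simp add: Suc X_def algebra_simps)
    then show ?thesis unfolding \<open>q * qbracket q n = X - 1\<close> .
  qed (simp add: X_def c_0)
  have pred: "c i * (theta (i - 1) - theta i) = c i * q / Q"
  proof (cases i)
    case (Suc n)
    then show ?thesis using q by (simp add: theta_Suc Q_def)
  qed (simp add: c_0)
  have ev: "eigenvalue * q = b 1 - q" using q by (simp add: eigenvalue_def field_simps)
  have th: "(b 0 - eigenvalue) * theta i * Q = b 0 * Q - (b 0 - eigenvalue) * q * X"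
  proof -
    have "(b 0 - eigenvalue) * theta i = b 0 - (b 0 - eigenvalue) * (\<Sum>j<i. 1 / q ^ j)"
      using eigenvalue_less(1) unfolding theta_def by (simp add: right_diff_distrib)
    then have "(b 0 - eigenvalue) * theta i * Q = (b 0 - (b 0 - eigenvalue) * (\<Sum>j<i. 1 / q ^ j)) * Q"
      by (rule arg_cong)
    also have "\<dots> = b 0 * Q - (b 0 - eigenvalue) * (Q * (\<Sum>j<i. 1 / q ^ j))"
      by (simp add: left_diff_distrib right_diff_distrib mult_ac)
    finally show ?thesis unfolding Q_def X_def sum_inverse_powers[OF q] by (simp only: mult_ac)
  qed
  have "T theta i - b 0 * theta i = c i * (theta (i - 1) - theta i) + b i * (theta (Suc i) - theta i)"
    unfolding T_def a_eq[OF assms] by (simp add: algebra_simps)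
  also have "\<dots> = (c i * q - b i) / Q"
    unfolding pred theta_Suc Q_def by (simp add: diff_divide_distrib)
  finally have "(T theta i - b 0 * theta i) * Q = c i * q - b i" using Q(1) by simp
  also have "\<dots> = - b 0 * Q + (b 0 - eigenvalue) * q * X"
  proof -
    have e: "(N * \<beta> - eigenvalue) * q = N * \<beta> * q - (N - 1) * (\<beta> - \<alpha>) + q"
      unfolding left_diff_distrib ev b0[symmetric] unfolding params(1,2) by (simp add: algebra_simps)
    show ?thesis unfolding Q(2) cq b b0 e by (simp add: algebra_simps)
  qed
  also have "\<dots> = - (b 0 - eigenvalue) * theta i * Q"
    using th by (simp add: algebra_simps)
  finally have "T theta i - b 0 * theta i = - (b 0 - eigenvalue) * theta i"
    using mult_right_cancel[OF Q(1)] by blast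
  then show ?thesis by (simp add: algebra_simps)
qed

text \<open>The sum depends only on the distance of \<open>u\<close> and \<open>v\<close>, say as
  \<open>g\<close>. Summing over the neighbours of \<open>v\<close> shows that \<open>g\<close>
  satisfies the recurrence of \<open>theta\<close>, and since \<open>b i > 0\<close> for
  \<open>i < D\<close> its solutions are determined by their value at 0.\<close>

lemma gram_theta:
  obtains \<kappa> where "\<And>u v. (\<Sum>y\<in>UNIV. theta (d y u) * theta (d y v)) = \<kappa> * theta (d u v)"
proof -
  define g where "g h = (\<Sum>i\<le>D. \<Sum>j\<le>D. real (intersection_number E h i j) * (theta i * theta j))" for h
  have g: "(\<Sum>y\<in>UNIV. theta (d y u) * theta (d y v)) = g (d u v)" for u v
  proof -
    have "(\<Sum>y\<in>UNIV. theta (d y u) * theta (d y v)) =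
        (\<Sum>i\<le>D. \<Sum>y\<in>{y\<in>UNIV. d y u = i}. theta (d y u) * theta (d y v))"
      by (rule sum.group[symmetric]) (use gdist_le_diameter diameter in auto)
    also have "\<dots> = (\<Sum>i\<le>D. \<Sum>j\<le>D. \<Sum>y\<in>{y\<in>{y\<in>UNIV. d y u = i}. d y v = j}. theta (d y u) * theta (d y v))"
      by (intro sum.cong refl sum.group[symmetric]) (use gdist_le_diameter diameter in auto)
    also have "\<dots> = g (d u v)"
      unfolding g_def
    proof (intro sum.cong refl)
      fix i j
      have "(\<Sum>y\<in>{y\<in>{y\<in>UNIV. d y u = i}. d y v = j}. theta (d y u) * theta (d y v)) =
          real (card {y. d u y = i \<and> d v y = j}) * (theta i * theta j)"
        by (simp add: gdist_sym[of u] gdist_sym[of v])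
      then show "(\<Sum>y\<in>{y\<in>{y\<in>UNIV. d y u = i}. d y v = j}. theta (d y u) * theta (d y v)) =
          real (intersection_number E (d u v) i j) * (theta i * theta j)"
        by (simp only: intersection_number)
    qed
    finally show ?thesis .
  qed
  have Tg: "T g h = eigenvalue * g h" if h: "h \<le> D" for h
  proof -
    obtain u where "u \<in> (UNIV :: 'v set)" by simp
    obtain v where v: "d u v = h" using ex_gdist[of h u] h diameter by auto
    have "T g (d u v) = (\<Sum>w | d v w = 1. g (d u w))"
      by (rule sum_neighbours[symmetric])
    also have "\<dots> = (\<Sum>y\<in>UNIV. \<Sum>w | d v w = 1. theta (d y u) * theta (d y w))"
      unfolding g[symmetric] by (rule sum.swap)
    also have "\<dots> = (\<Sum>y\<in>UNIV. theta (d y u) * (eigenvalue * theta (d y v)))"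
      using gdist_le_diameter unfolding diameter
      by (simp only: sum_distrib_left[symmetric] sum_neighbours T_theta)
    also have "\<dots> = eigenvalue * g (d u v)"
      unfolding g[symmetric] sum_distrib_left by (simp add: mult_ac)
    finally show ?thesis using v by simp
  qed
  have ratio: "h \<le> D \<Longrightarrow> g h * theta 0 = g 0 * theta h" for h
  proof (induction h rule: less_induct)
    case (less h)
    show ?case
    proof (cases h)
      case (Suc i)
      have i: "i \<le> D" "i < D" using less.prems Suc by auto
      have "b i > 0" using b_pos[of i] i diameter by simp
      have 1: "g i * theta 0 = g 0 * theta i" using less.IH[of i] Suc i by simp
      have 2: "c i * (g (i - 1) * theta 0) = c i * (g 0 * theta (i - 1))"
        using less.IH[of "i - 1"] Suc i by simp
      have "b i * g (Suc i) = eigenvalue * g i - a i * g i - c i * g (i - 1)"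
        using Tg[OF i(1)] unfolding T_def by simp
      then have "b i * (g (Suc i) * theta 0) =
          eigenvalue * (g i * theta 0) - a i * (g i * theta 0) - c i * (g (i - 1) * theta 0)"
        by (simp only: mult.assoc[symmetric] left_diff_distrib)
      also have "\<dots> = g 0 * (eigenvalue * theta i - a i * theta i - c i * theta (i - 1))"
        unfolding 1 2 by (simp add: algebra_simps)
      also have "eigenvalue * theta i - a i * theta i - c i * theta (i - 1) = b i * theta (Suc i)"
        using T_theta[OF i(1)] unfolding T_def by simp
      finally have "b i * (g (Suc i) * theta 0) = b i * (g 0 * theta (Suc i))" by simp
      then show ?thesis using \<open>b i > 0\<close> Suc by simp
    qed simp
  qed
  have scale: "g h = g 0 / theta 0 * theta h" if "h \<le> D" for h
    using ratio[OF that] eigenvalue_less(2) by (simp add: eq_divide_eq)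
  have "(\<Sum>y\<in>UNIV. theta (d y u) * theta (d y v)) = g 0 / theta 0 * theta (d u v)" for u v
    unfolding g using gdist_le_diameter[of u v] unfolding diameter by (rule scale)
  then show ?thesis by (rule that)
qed

end

section \<open>The cubic relation\<close>

text \<open>The condition behind \<open>wop_T_delta\<close> at distance 2; \<open>A\<close>,
  \<open>C\<close>, \<open>K\<close> are the cofactors of the brackets in \<open>a 2\<close>,
  \<open>c 2\<close>, \<open>c 3\<close>, and \<open>r\<close> is \<open>1 / q\<close>. With
  \<open>g\<close> and \<open>rho\<close> inserted, the expression is \<open>B\<close> times a
  polynomial that vanishes by \<open>key\<close>.\<close>

lemma cubic_coefficient_identity:
  fixes q r A C K a1 a2 b0 b1 b2 c2 c3 B g rho :: real
  assumes qr: "q * r = 1" and B: "B = q + 1 + r" and a2: "a2 = (1 + q) * A"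
    and c2: "c2 = (1 + q) * C" and c3: "c3 = (1 + q + q\<^sup>2) * K" and g: "g = a1 + a2 - B * A"
    and rho: "rho = b0 + a1\<^sup>2 + b1 * c2 - B * (b1 * c2 * r - b0) - g * a1"
    and key: "b2 * K = q * A * (A - a1) + b1 * C * (q + 1) - q * b0"
  shows "a1\<^sup>2 + a1 * a2 + a2\<^sup>2 + b0 + b1 * c2 + b2 * c3 - g * (a1 + a2) - rho
    - B * (q * b0 + a1 * a2 - b1 * c2 + b2 * c3 * r) = 0"
proof -
  have q2: "1 + q + q\<^sup>2 = q * B" unfolding B using qr by (simp add: algebra_simps power2_eq_square)
  have "a1\<^sup>2 + a1 * a2 + a2\<^sup>2 + b0 + b1 * c2 + b2 * c3 - g * (a1 + a2) - rho
    - B * (q * b0 + a1 * a2 - b1 * c2 + b2 * c3 * r)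
    = B * ((1 + q) * A\<^sup>2 + b1 * C * (1 + q) * (r + 1) - (1 + q) * b0 - (1 + q) * a1 * A
        + (b2 * K * q - (q * r) * B * (b2 * K)))"
    unfolding rho g c3 q2 a2 c2 by (simp add: algebra_simps power2_eq_square)
  also have "b2 * K * q - (q * r) * B * (b2 * K) = - (b2 * K) * (1 + r)"
    unfolding qr B by (simp add: algebra_simps)
  also have "(1 + q) * A\<^sup>2 + b1 * C * (1 + q) * (r + 1) - (1 + q) * b0 - (1 + q) * a1 * A + - (b2 * K) * (1 + r) = 0"
  proof -
    have "- (b2 * K) * (1 + r) = - (q * (1 + r)) * (A * (A - a1)) - b1 * C * (q + 1) * (1 + r) + q * (1 + r) * b0"
      unfolding key by (simp add: algebra_simps)
    moreover have "q * (1 + r) = 1 + q" using qr by (simp add: algebra_simps)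
    ultimately show ?thesis by (simp add: algebra_simps power2_eq_square)
  qed
  finally show ?thesis by simp
qed

context classical_negative
begin

section \<open>Walk counts and the defect of the cubic relation\<close>

definition delta :: "nat \<Rightarrow> real" where "delta i = (if i = 0 then 1 else 0)"

text \<open>The \<open>(u, v)\<close> entry of the \<open>n\<close>-th power of the adjacency
  matrix: \<open>delta\<close> is the indicator of the base vertex and each \<open>T\<close> adds
  one step.\<close>

definition walks :: "nat \<Rightarrow> 'v \<Rightarrow> 'v \<Rightarrow> real" where
  "walks n u v = (T ^^ n) delta (d u v)"

lemma walks_sym: "walks n u v = walks n v u"
  by (simp add: walks_def gdist_sym)

lemma walks_0: "walks 0 u v = (if u = v then 1 else 0)"
  by (simp add: walks_def delta_def)

lemma walks_Suc: "walks (Suc n) u v = (\<Sum>w | d u w = 1. walks n w v)"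
  unfolding walks_def gdist_sym[of _ v] by (simp only: sum_neighbours funpow.simps comp_apply)

lemma sum_walks: "(\<Sum>v\<in>UNIV. walks n u v * f (d s v)) = (T ^^ n) f (d s u)"
proof (induction n arbitrary: u)
  case 0
  have "(\<Sum>v\<in>UNIV. walks 0 u v * f (d s v)) = (\<Sum>v\<in>UNIV. if u = v then f (d s v) else 0)"
    by (rule sum.cong) (simp_all add: walks_0)
  then show ?case by simp
next
  case (Suc n)
  have "(\<Sum>v\<in>UNIV. walks (Suc n) u v * f (d s v)) =
      (\<Sum>v\<in>UNIV. \<Sum>w | d u w = 1. walks n w v * f (d s v))"
    by (simp only: walks_Suc sum_distrib_right)
  also have "\<dots> = (\<Sum>w | d u w = 1. \<Sum>v\<in>UNIV. walks n w v * f (d s v))"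
    by (rule sum.swap)
  also have "\<dots> = (T ^^ Suc n) f (d s u)"
    unfolding Suc by (simp only: sum_neighbours funpow.simps comp_apply)
  finally show ?case .
qed

text \<open>The coefficients of the cubic relation \<open>A\<^sup>3 F - F A\<^sup>3 = B (A\<^sup>2 F A - A F A\<^sup>2) +
  \<gamma> (A\<^sup>2 F - F A\<^sup>2) + \<rho> (A F - F A)\<close>, to be satisfied by every diagonal matrix
  \<open>F\<close> with entries \<open>theta (d y v)\<close>; \<gamma> and \<rho> are forced by its column at \<open>y\<close>.\<close>

definition coeff :: real where "coeff = q + 1 + 1 / q"
definition gam :: real where "gam = a 1 + a 2 - coeff * a 2 / (q + 1)"
definition rho :: real where
  "rho = b 0 + (a 1)\<^sup>2 + b 1 * c 2 - coeff * (b 1 * c 2 / q - b 0) - gam * a 1"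

text \<open>With \<open>h i j\<close> standing for \<open>A^i F A^j\<close>, this is the left side
  of the cubic relation minus the right side. It is linear in \<open>h\<close> and odd under
  exchange of the two indices.\<close>

definition skew :: "(nat \<Rightarrow> nat \<Rightarrow> real) \<Rightarrow> real" where
  "skew h = h 3 0 - h 0 3 - coeff * (h 2 1 - h 1 2) - gam * (h 2 0 - h 0 2) - rho * (h 1 0 - h 0 1)"

lemma skew_sum: "skew (\<lambda>i j. \<Sum>x\<in>S. h x i j) = (\<Sum>x\<in>S. skew (h x))"
  by (simp only: skew_def sum_subtractf sum_distrib_left[symmetric])

lemma skew_mult_right: "skew (\<lambda>i j. h i j * k) = skew h * k"
  by (simp add: skew_def algebra_simps)

lemma skew_swap: "skew (\<lambda>i j. h j i) = - skew h"
  by (simp add: skew_def algebra_simps)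

definition W :: "'v \<Rightarrow> 'v \<Rightarrow> 'v \<Rightarrow> real" where
  "W s u v = skew (\<lambda>i j. \<Sum>w\<in>UNIV. walks i u w * walks j w v * theta (d s w))"

text \<open>The defect \<open>W s\<close> acting on functions of the distance from \<open>s\<close>,
  where \<open>A\<close> acts as \<open>T\<close> and \<open>F\<close> multiplies by
  \<open>theta\<close>.\<close>

definition wop :: "(nat \<Rightarrow> real) \<Rightarrow> nat \<Rightarrow> real" where
  "wop f h = skew (\<lambda>i j. (T ^^ i) (\<lambda>n. theta n * (T ^^ j) f n) h)"

lemma W_swap: "W s v u = - W s u v"
proof -
  have "W s v u = skew (\<lambda>i j. \<Sum>w\<in>UNIV. walks j u w * walks i w v * theta (d s w))"
    unfolding W_def walks_sym[of _ v] walks_sym[of _ _ u] by (simp only: mult_ac)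
  also have "\<dots> = - W s u v"
    unfolding W_def by (rule skew_swap)
  finally show ?thesis .
qed

lemma W_apply: "(\<Sum>v\<in>UNIV. W s u v * f (d s v)) = wop f (d s u)"
proof -
  have "(\<Sum>v\<in>UNIV. W s u v * f (d s v)) =
      (\<Sum>v\<in>UNIV. skew (\<lambda>i j. (\<Sum>w\<in>UNIV. walks i u w * walks j w v * theta (d s w)) * f (d s v)))"
    by (simp only: W_def skew_mult_right)
  also have "\<dots> =
      skew (\<lambda>i j. \<Sum>v\<in>UNIV. (\<Sum>w\<in>UNIV. walks i u w * walks j w v * theta (d s w)) * f (d s v))"
    by (rule skew_sum[symmetric])
  also have "(\<lambda>i j. \<Sum>v\<in>UNIV. (\<Sum>w\<in>UNIV. walks i u w * walks j w v * theta (d s w)) * f (d s v)) =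
      (\<lambda>i j. (T ^^ i) (\<lambda>n. theta n * (T ^^ j) f n) (d s u))"
  proof (intro ext)
    fix i j
    have "(\<Sum>v\<in>UNIV. (\<Sum>w\<in>UNIV. walks i u w * walks j w v * theta (d s w)) * f (d s v)) =
        (\<Sum>v\<in>UNIV. \<Sum>w\<in>UNIV. walks i u w * (theta (d s w) * (walks j w v * f (d s v))))"
      unfolding sum_distrib_right by (simp only: mult_ac)
    also have "\<dots> = (\<Sum>w\<in>UNIV. \<Sum>v\<in>UNIV. walks i u w * (theta (d s w) * (walks j w v * f (d s v))))"
      by (rule sum.swap)
    also have "\<dots> = (T ^^ i) (\<lambda>n. theta n * (T ^^ j) f n) (d s u)"
      unfolding sum_distrib_left[symmetric] sum_walks by (rule sum_walks)
    finally show "(\<Sum>v\<in>UNIV. (\<Sum>w\<in>UNIV. walks i u w * walks j w v * theta (d s w)) * f (d s v)) =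
      (T ^^ i) (\<lambda>n. theta n * (T ^^ j) f n) (d s u)" .
  qed
  finally show ?thesis unfolding wop_def .
qed

section \<open>Evaluation of the defect near its base vertex\<close>

lemma T_numerals:
  "T f 0 = b 0 * f 1"
  "T f (Suc 0) = f 0 + a 1 * f 1 + b 1 * f 2"
  "T f 1 = f 0 + a 1 * f 1 + b 1 * f 2"
  "T f 2 = c 2 * f 1 + a 2 * f 2 + b 2 * f 3"
  "T f 3 = c 3 * f 2 + a 3 * f 3 + b 3 * f 4"
  "T f 4 = c 4 * f 3 + a 4 * f 4 + b 4 * f 5"
  "T f 5 = c 5 * f 4 + a 5 * f 5 + b 5 * f 6"
  using c1 by (simp_all add: T_def c_0 a_0 eval_nat_numeral)

lemma funpow_numerals:
  "(T ^^ 0) f = f" "(T ^^ 1) f = T f" "(T ^^ Suc 0) f = T f" "(T ^^ 2) f = T (T f)" "(T ^^ 3) f = T (T (T f))"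
  by (simp_all add: numeral_2_eq_2 numeral_3_eq_3)

lemma theta_numerals:
  "theta 1 = theta 0 - 1" "theta (Suc 0) = theta 0 - 1" "theta 2 = theta 0 - 1 - 1 / q" "theta 3 = theta 0 - 1 - 1 / q - 1 / q * (1 / q)"
  using theta_Suc[of 0] theta_Suc[of 1] theta_Suc[of 2]
  by (simp_all add: numeral_3_eq_3 numeral_2_eq_2)

lemma delta_numerals: "delta 0 = 1" "delta 1 = 0" "delta (Suc 0) = 0" "delta (numeral k) = 0"
  by (simp_all add: delta_def)

text \<open>This is the column of \<open>W s\<close> at \<open>s\<close>. The choices of
  \<open>rho\<close>, \<open>gam\<close> and \<open>coeff\<close> make it vanish at distances 1, 2
  and 3; at distance 0 the terms cancel, and beyond 3 no walk of length 3 arrives.\<close>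

lemma wop_delta: "wop delta h = 0"
proof -
  have q: "q \<noteq> 0" "q + 1 \<noteq> 0" using q_less by simp_all
  consider "h = 0" | "h = 1" | "h = 2" | "h = 3" | m where "h = Suc (Suc (Suc (Suc m)))"
    by (metis One_nat_def nat.exhaust numeral_2_eq_2 numeral_3_eq_3)
  then show ?thesis
  proof cases
    case 1
    then show ?thesis
      by (simp add: wop_def skew_def funpow_numerals T_numerals delta_numerals algebra_simps)
  next
    case 2
    show ?thesis unfolding 2
      by (simp add: wop_def skew_def funpow_numerals T_numerals delta_numerals theta_numerals rho_def
          algebra_simps power2_eq_square)
  next
    case 3
    have "(a 1 + a 2 - gam) * (1 + 1 / q) = coeff * a 2 / q"
    proof -
      have "1 + 1 / q = (q + 1) / q" using q by (simp add: add_divide_distrib)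
      then show ?thesis using q by (simp add: gam_def)
    qed
    then have "c 2 * ((a 1 + a 2 - gam) * (1 + 1 / q)) = c 2 * (coeff * a 2 / q)"
      by (rule arg_cong)
    then show ?thesis unfolding 3
      by (simp add: wop_def skew_def funpow_numerals T_numerals delta_numerals theta_numerals
          algebra_simps add_divide_distrib)
  next
    case 4
    have "coeff * (1 / q) = 1 + 1 / q + 1 / q * (1 / q)"
      using q by (simp add: coeff_def field_simps)
    then have "c 2 * c 3 * (coeff * (1 / q)) = c 2 * c 3 * (1 + 1 / q + 1 / q * (1 / q))"
      by (rule arg_cong)
    then show ?thesis unfolding 4
      by (simp add: wop_def skew_def funpow_numerals T_numerals delta_numerals theta_numerals
          algebra_simps add_divide_distrib)
  next
    case 5
    then show ?thesis
      by (simp add: wop_def skew_def numeral_2_eq_2 numeral_3_eq_3 T_def delta_def)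
  qed
qed

text \<open>To be paired with walks of length 2, which reach distance 2 at most. Distance 0 is
  settled by \<open>rho\<close> and distance 1 by cancellation; at distance 2 the coefficients are
  already fixed, and the formulas for the classical parameters enter.\<close>

lemma wop_T_delta:
  assumes "h \<le> 2"
  shows "wop (T delta) h = 0"
proof -
  have q: "q \<noteq> 0" "q + 1 \<noteq> 0" using q_less by simp_all
  from assms consider "h = 0" | "h = 1" | "h = 2" by linarith
  then show ?thesis
  proof cases
    case 1
    show ?thesis unfolding 1
      by (simp add: wop_def skew_def funpow_numerals T_numerals delta_numerals theta_numerals rho_def
          algebra_simps power2_eq_square)
  next
    case 2
    show ?thesis unfolding 2
      by (simp add: wop_def skew_def funpow_numerals T_numerals delta_numerals theta_numerals
          algebra_simps add_divide_distrib)
  next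
    case 3
    define r where "r = 1 / q"
    have qr: "q * r = 1" using q by (simp add: r_def)
    have qr': "q * (r * t) = t" for t using qr by (simp flip: mult.assoc)
    define A where "A = N * \<alpha> + \<beta> - \<alpha> * (1 + q) - 1 - \<alpha>"
    have a2: "a 2 = (1 + q) * A" unfolding params A_def ..
    have B: "coeff = q + 1 + r" by (simp add: coeff_def r_def)
    have g: "gam = a 1 + a 2 - coeff * A"
      using q unfolding gam_def a2 by (simp add: add.commute)
    have "wop (T delta) 2 = c 2 * r * (((a 1)\<^sup>2 + a 1 * a 2 + (a 2)\<^sup>2 + b 0 + b 1 * c 2 + b 2 * c 3
        - gam * (a 1 + a 2) - rho) - coeff * (q * b 0 + a 1 * a 2 - b 1 * c 2 + b 2 * c 3 * r))"
      by (simp add: wop_def skew_def funpow_numerals T_numerals delta_numerals theta_numerals r_def[symmetric] qr'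
        algebra_simps power2_eq_square)
    also have "(a 1)\<^sup>2 + a 1 * a 2 + (a 2)\<^sup>2 + b 0 + b 1 * c 2 + b 2 * c 3
        - gam * (a 1 + a 2) - rho - coeff * (q * b 0 + a 1 * a 2 - b 1 * c 2 + b 2 * c 3 * r) = 0"
    proof (rule cubic_coefficient_identity[OF qr B a2 params(4,5) g])
      show "rho = b 0 + (a 1)\<^sup>2 + b 1 * c 2 - coeff * (b 1 * c 2 * r - b 0) - gam * a 1"
        by (simp add: rho_def r_def)
      show "b 2 * (1 + \<alpha> * (1 + q)) = q * A * (A - a 1) + b 1 * (1 + \<alpha>) * (q + 1) - q * b 0"
        unfolding A_def params by (simp add: algebra_simps)
    qed
    finally show ?thesis unfolding 3 by simp
  qed
qed

lemma W_eq_sum: "W s u v = (\<Sum>w\<in>UNIV. skew (\<lambda>i j. walks i u w * walks j w v) * theta (d s w))"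
  unfolding W_def by (simp only: skew_sum skew_mult_right)

text \<open>The double sum \<open>U i j\<close> is the \<open>(s, s)\<close> entry of
  \<open>A^i W_s A^j\<close>, antisymmetric in \<open>i\<close>, \<open>j\<close> because
  \<open>W_s\<close> is. So only \<open>U i 0\<close> and \<open>U 2 1\<close> remain, and these are
  sums of values of \<open>wop\<close> on \<open>delta\<close> and \<open>T delta\<close>.\<close>

lemma W_contract:
  "skew (\<lambda>i j. \<Sum>u\<in>UNIV. \<Sum>v\<in>UNIV. walks i u s * walks j s v * W s u v) = 0"
proof -
  define U where "U i j = (\<Sum>u\<in>UNIV. \<Sum>v\<in>UNIV. walks i u s * walks j s v * W s u v)" for i j
  have inner: "U i j = (\<Sum>u\<in>UNIV. walks i u s * wop ((T ^^ j) delta) (d s u))" for i j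
    unfolding U_def W_apply[symmetric] sum_distrib_left
    by (simp only: walks_def mult_ac)
  have anti: "U j i = - U i j" for i j
  proof -
    have "U j i = (\<Sum>v\<in>UNIV. \<Sum>u\<in>UNIV. walks j u s * walks i s v * W s u v)"
      unfolding U_def by (rule sum.swap)
    also have "\<dots> = (\<Sum>u\<in>UNIV. \<Sum>v\<in>UNIV. - (walks i u s * walks j s v * W s u v))"
    proof (intro sum.cong refl)
      fix u v
      show "walks j v s * walks i s u * W s v u = - (walks i u s * walks j s v * W s u v)"
        unfolding W_swap[of s v u] walks_sym[of j v s] walks_sym[of i s u] by simp
    qed
    finally show ?thesis by (simp add: U_def sum_negf)
  qed
  have U0: "U i 0 = 0" for i
    unfolding inner by (simp add: wop_delta)
  have U0': "U 0 i = 0" for i using anti[of i 0] U0[of i] by simp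
  have zero: "walks 2 u s * wop ((T ^^ 1) delta) (d s u) = 0" for u
  proof (cases "d s u \<le> 2")
    case True
    then show ?thesis by (simp add: wop_T_delta)
  next
    case False
    \<comment> \<open>These are all the arguments at which \<open>T (T delta)\<close> evaluates
      \<open>delta\<close>; from distance 3 on none of them is 0.\<close>
    then have "delta (d s u - 1 - 1) = 0" "delta (d s u - 1) = 0" "delta (d s u) = 0"
      "delta (d s u - 1 + 1) = 0" "delta (d s u + 1 - 1) = 0" "delta (d s u + 1) = 0" "delta (d s u + 1 + 1) = 0"
      by (auto simp: delta_def)
    then have "walks 2 u s = 0"
      unfolding walks_def gdist_sym[of u s] funpow_numerals T_def by (simp only: mult_zero_right add_0_left)
    then show ?thesis by simp
  qed
  have U21: "U 2 1 = 0" unfolding inner by (intro sum.neutral ballI zero)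
  have "U 1 2 = 0" using anti[of 1 2] U21 by simp
  then have "skew U = 0" unfolding skew_def using U0 U0' U21 by simp
  then show ?thesis unfolding U_def .
qed

text \<open>Each entry of \<open>W y\<close> combines the numbers \<open>theta (d y s)\<close> with
  coefficients free of \<open>y\<close>. Summing the squares over \<open>y\<close> turns products of
  these numbers into Gram entries, after which one of the two vertex sums folds back into
  \<open>W s u v\<close>.\<close>

lemma sum_square_W: "\<exists>\<kappa>. \<forall>u v. (\<Sum>y\<in>UNIV. (W y u v)\<^sup>2) =
    \<kappa> * (\<Sum>s\<in>UNIV. skew (\<lambda>i j. walks i u s * walks j s v) * W s u v)"
proof -
  obtain \<kappa> where \<kappa>: "\<And>u v. (\<Sum>y\<in>UNIV. theta (d y u) * theta (d y v)) = \<kappa> * theta (d u v)"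
    using gram_theta by blast
  have "(\<Sum>y\<in>UNIV. (W y u v)\<^sup>2) =
      \<kappa> * (\<Sum>s\<in>UNIV. skew (\<lambda>i j. walks i u s * walks j s v) * W s u v)" for u v
  proof -
    define Z where "Z s = skew (\<lambda>i j. walks i u s * walks j s v)" for s
    have W: "W y u v = (\<Sum>s\<in>UNIV. Z s * theta (d y s))" for y
      unfolding W_eq_sum Z_def ..
    have "(\<Sum>y\<in>UNIV. (W y u v)\<^sup>2) =
        (\<Sum>y\<in>UNIV. \<Sum>s\<in>UNIV. \<Sum>w\<in>UNIV. Z s * Z w * (theta (d y s) * theta (d y w)))"
      unfolding W power2_eq_square sum_product by (simp only: mult_ac)
    also have "\<dots> = (\<Sum>s\<in>UNIV. \<Sum>y\<in>UNIV. \<Sum>w\<in>UNIV. Z s * Z w * (theta (d y s) * theta (d y w)))"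
      by (rule sum.swap)
    also have "\<dots> = (\<Sum>s\<in>UNIV. \<Sum>w\<in>UNIV. \<Sum>y\<in>UNIV. Z s * Z w * (theta (d y s) * theta (d y w)))"
      by (intro sum.cong refl sum.swap)
    also have "\<dots> = (\<Sum>s\<in>UNIV. \<Sum>w\<in>UNIV. Z s * Z w * (\<kappa> * theta (d s w)))"
      unfolding sum_distrib_left[symmetric] \<kappa> ..
    also have "\<dots> = \<kappa> * (\<Sum>s\<in>UNIV. Z s * W s u v)"
      unfolding W sum_distrib_left by (simp only: mult_ac)
    finally show ?thesis unfolding Z_def .
  qed
  then show ?thesis by blast
qed

text \<open>Summed over \<open>u\<close> and \<open>v\<close> as well, the right side becomes a sum
  over \<open>s\<close> of the contractions in \<open>W_contract\<close>, hence 0; a vanishing sum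
  of real squares has vanishing terms.\<close>

lemma W_zero: "W s u v = 0"
proof -
  obtain \<kappa> where \<kappa>: "\<And>u v. (\<Sum>y\<in>UNIV. (W y u v)\<^sup>2) =
      \<kappa> * (\<Sum>s\<in>UNIV. skew (\<lambda>i j. walks i u s * walks j s v) * W s u v)"
    using sum_square_W by blast
  have "(\<Sum>u\<in>UNIV. \<Sum>v\<in>UNIV. \<Sum>y\<in>UNIV. (W y u v)\<^sup>2) =
      \<kappa> * (\<Sum>u\<in>UNIV. \<Sum>v\<in>UNIV. \<Sum>s\<in>UNIV. skew (\<lambda>i j. walks i u s * walks j s v) * W s u v)"
    unfolding \<kappa> sum_distrib_left ..
  also have "(\<Sum>u\<in>UNIV. \<Sum>v\<in>UNIV. \<Sum>s\<in>UNIV. skew (\<lambda>i j. walks i u s * walks j s v) * W s u v) =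
      (\<Sum>u\<in>UNIV. \<Sum>s\<in>UNIV. \<Sum>v\<in>UNIV. skew (\<lambda>i j. walks i u s * walks j s v) * W s u v)"
    by (intro sum.cong refl sum.swap)
  also have "\<dots> = (\<Sum>s\<in>UNIV. \<Sum>u\<in>UNIV. \<Sum>v\<in>UNIV. skew (\<lambda>i j. walks i u s * walks j s v) * W s u v)"
    by (rule sum.swap)
  also have "\<dots> = (\<Sum>s\<in>UNIV. skew (\<lambda>i j. \<Sum>u\<in>UNIV. \<Sum>v\<in>UNIV. walks i u s * walks j s v * W s u v))"
    by (simp only: skew_sum skew_mult_right)
  also have "\<dots> = 0" unfolding W_contract by simp
  finally have "(\<Sum>u\<in>UNIV. \<Sum>v\<in>UNIV. \<Sum>y\<in>UNIV. (W y u v)\<^sup>2) = 0" by simp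
  then have "(\<Sum>v\<in>UNIV. \<Sum>y\<in>UNIV. (W y u v)\<^sup>2) = 0"
    by (rule sum_nonneg_0[OF finite _ _ UNIV_I, rotated]) (intro sum_nonneg zero_le_power2)
  then have "(\<Sum>y\<in>UNIV. (W y u v)\<^sup>2) = 0"
    by (rule sum_nonneg_0[OF finite _ _ UNIV_I, rotated]) (intro sum_nonneg zero_le_power2)
  then have "(W s u v)\<^sup>2 = 0"
    by (rule sum_nonneg_0[OF finite _ _ UNIV_I, rotated]) (intro zero_le_power2)
  then show ?thesis by simp
qed

end

section \<open>Kites\<close>

lemma sum_by_levels:
  fixes g :: "nat \<Rightarrow> nat \<Rightarrow> real"
  assumes "\<And>s. s \<in> S \<Longrightarrow> f s \<le> k \<and> h s \<le> l" "finite S"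
  shows "(\<Sum>s\<in>S. g (f s) (h s)) = (\<Sum>i\<le>k. \<Sum>j\<le>l. real (card {s \<in> S. f s = i \<and> h s = j}) * g i j)"
proof -
  have "(\<Sum>s\<in>S. g (f s) (h s)) = (\<Sum>i\<le>k. \<Sum>s\<in>{s\<in>S. f s = i}. g (f s) (h s))"
    by (rule sum.group[symmetric]) (use assms in auto)
  also have "\<dots> = (\<Sum>i\<le>k. \<Sum>j\<le>l. \<Sum>s\<in>{s\<in>{s\<in>S. f s = i}. h s = j}. g (f s) (h s))"
    by (intro sum.cong refl sum.group[symmetric]) (use assms in auto)
  also have "\<dots> = (\<Sum>i\<le>k. \<Sum>j\<le>l. real (card {s \<in> S. f s = i \<and> h s = j}) * g i j)"
    by (intro sum.cong refl) (simp add: conj_assoc)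
  finally show ?thesis .
qed

lemma card_by_levels:
  assumes "\<And>s. s \<in> S \<Longrightarrow> h s \<le> 3" "finite S"
  shows "card S = card {s \<in> S. h s = 0} + card {s \<in> S. h s = 1} + card {s \<in> S. h s = 2} + card {s \<in> S. h s = (3::nat)}"
proof -
  have "card S = (\<Sum>s\<in>S. 1)" by simp
  also have "\<dots> = (\<Sum>j\<le>3. \<Sum>s\<in>{s\<in>S. h s = j}. 1)"
    by (rule sum.group[symmetric]) (use assms in auto)
  also have "\<dots> = (\<Sum>j\<le>3. card {s \<in> S. h s = j})" by simp
  finally show ?thesis by (simp add: numeral_3_eq_3 numeral_2_eq_2)
qed

context classical_negative
begin

section \<open>Excluding kites by the sign of \<open>q\<close>\<close>

lemma walks_1: "walks 1 u v = (if d u v = 1 then 1 else 0)"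
proof -
  have "T delta n = (if n = 1 then 1 else 0)" for n
    using c1 by (cases n rule: nat.exhaust) (auto simp: T_def delta_def a_0 c_0)
  then show ?thesis by (simp add: walks_def)
qed

text \<open>The \<open>(x, w)\<close> entry of the cubic relation based at \<open>y\<close>: where
  \<open>F\<close> stands at an end, its diagonal entry factors out.\<close>

lemma triple_relation:
  "(walks 3 x w - gam * walks 2 x w - rho * walks 1 x w) * (theta (d y w) - theta (d y x)) =
    coeff * ((\<Sum>s | d w s = 1. walks 2 x s * theta (d y s)) - (\<Sum>s | d x s = 1. walks 2 w s * theta (d y s)))"
proof -
  define h where "h i j = (\<Sum>s\<in>UNIV. walks i x s * walks j s w * theta (d y s))" for i j
  have h0: "h i 0 = walks i x w * theta (d y w)" for i
  proof -
    have "h i 0 = (\<Sum>s\<in>UNIV. if s = w then walks i x w * theta (d y w) else 0)"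
      unfolding h_def by (rule sum.cong) (auto simp: walks_0)
    then show ?thesis by simp
  qed
  have h0': "h 0 i = walks i x w * theta (d y x)" for i
  proof -
    have "h 0 i = (\<Sum>s\<in>UNIV. if s = x then walks i x w * theta (d y x) else 0)"
      unfolding h_def by (rule sum.cong) (auto simp: walks_0)
    then show ?thesis by simp
  qed
  have h21: "h 2 1 = (\<Sum>s | d w s = 1. walks 2 x s * theta (d y s))"
  proof -
    have "h 2 1 = (\<Sum>s\<in>UNIV. if d w s = 1 then walks 2 x s * theta (d y s) else 0)"
      unfolding h_def walks_1 gdist_sym[of _ w] by (rule sum.cong) auto
    also have "\<dots> = (\<Sum>s\<in>{s\<in>UNIV. d w s = 1}. walks 2 x s * theta (d y s))"
      by (rule sum.inter_filter[symmetric]) simp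
    finally show ?thesis by simp
  qed
  have h12: "h 1 2 = (\<Sum>s | d x s = 1. walks 2 w s * theta (d y s))"
  proof -
    have "h 1 2 = (\<Sum>s\<in>UNIV. if d x s = 1 then walks 2 w s * theta (d y s) else 0)"
      unfolding h_def walks_1 walks_sym[of 2 _ w] by (rule sum.cong) auto
    also have "\<dots> = (\<Sum>s\<in>{s\<in>UNIV. d x s = 1}. walks 2 w s * theta (d y s))"
      by (rule sum.inter_filter[symmetric]) simp
    finally show ?thesis by simp
  qed
  have "skew h = 0" using W_zero[of y x w] unfolding W_def h_def .
  then show ?thesis
    unfolding skew_def h0 h0' h21 h12 by (simp add: algebra_simps)
qed

text \<open>Neighbours of \<open>w\<close> and of \<open>x\<close> are sorted by their distances to
  the other two vertices. Both sums in \<open>triple_relation\<close> then depend on intersection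
  numbers and three unknown counts; the number of common neighbours of all three vertices cancels,
  which leaves a relation between the other two.\<close>

lemma kite_balance:
  assumes xy: "d x y = 1" and xw: "d x w = 2" and yw: "d y w = 2"
  shows "real (card {s. d w s = 1 \<and> d x s = 2 \<and> d y s = 3}) =
    q * real (card {s. d x s = 1 \<and> d w s = 3 \<and> d y s = 1})"
proof -
  define n where "n i j = card {s. d w s = 1 \<and> d x s = i \<and> d y s = j}" for i j
  define m where "m i j = card {s. d x s = 1 \<and> d w s = i \<and> d y s = j}" for i j
  note sy = gdist_sym[of y x] gdist_sym[of w x] gdist_sym[of w y]
  have wx: "d w x = 2" and wy: "d w y = 2" and yx: "d y x = 1" using xy xw yw sy by simp_all
  have bn: "d x s \<le> 3 \<and> d y s \<le> 3" if "d w s = 1" for s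
    using that gdist_triangle[of x s w] gdist_triangle[of y s w] xw yw by linarith
  have bm: "d w s \<le> 3 \<and> d y s \<le> 2" if "d x s = 1" for s
    using that gdist_triangle[of w s x] gdist_triangle[of y s x] wx yx by linarith
  have dd: "d x s \<le> 1 + d y s" "d y s \<le> 1 + d x s" for s
    using gdist_triangle[of x s y] gdist_triangle[of y s x] xy yx by linarith+
  have n0: "n 0 j = 0" "n i 0 = 0" "n 1 3 = 0" "n 3 1 = 0" for i j
  proof -
    show "n 0 j = 0" using wx unfolding n_def by (simp only: gdist_eq_0) (auto simp: card_eq_0_iff)
    show "n i 0 = 0" using wy unfolding n_def by (simp only: gdist_eq_0) (auto simp: card_eq_0_iff)
    have "\<not> (d x s = 1 \<and> d y s = 3)" "\<not> (d x s = 3 \<and> d y s = 1)" for s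
      using dd[of s] by linarith+
    then show "n 1 3 = 0" "n 3 1 = 0" unfolding n_def by simp_all
  qed
  \<comment> \<open>The value \<open>m 2 0 = 1\<close> counts \<open>y\<close> itself.\<close>
  have m0: "m 0 j = 0" "m 1 0 = 0" "m 2 0 = 1" "m 3 0 = 0" "m i 3 = 0" for i j
  proof -
    show "m 0 j = 0" using xw unfolding m_def by (simp only: gdist_eq_0) (auto simp: card_eq_0_iff)
    show "m 1 0 = 0" "m 3 0 = 0" using wy unfolding m_def by (auto simp: card_eq_0_iff)
    have "{s. d x s = 1 \<and> d w s = 2 \<and> d y s = 0} = {y}" using wy xy by auto
    then show "m 2 0 = 1" unfolding m_def by simp
    have "\<not> (d x s = 1 \<and> d w s = i \<and> d y s = 3)" for s
      using bm[of s] by linarith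
    then show "m i 3 = 0" unfolding m_def by simp
  qed
  have row_n: "card {s. d w s = 1 \<and> d x s = i} = n i 0 + n i 1 + n i 2 + n i 3" for i
    using card_by_levels[of "{s. d w s = 1 \<and> d x s = i}" "d y"] bn by (simp add: n_def conj_assoc)
  have col_n: "card {s. d w s = 1 \<and> d y s = j} = n 0 j + n 1 j + n 2 j + n 3 j" for j
    using card_by_levels[of "{s. d w s = 1 \<and> d y s = j}" "d x"] bn by (simp add: n_def conj_ac)
  have row_m: "card {s. d x s = 1 \<and> d w s = i} = m i 0 + m i 1 + m i 2 + m i 3" for i
    using card_by_levels[of "{s. d x s = 1 \<and> d w s = i}" "d y"] bm by (force simp: m_def conj_assoc)
  have col_m: "card {s. d x s = 1 \<and> d y s = j} = m 0 j + m 1 j + m 2 j + m 3 j" for j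
    using card_by_levels[of "{s. d x s = 1 \<and> d y s = j}" "d w"] bm by (simp add: m_def conj_ac)
  have e1: "n 1 1 + n 1 2 = c_num E 2" using row_n[of 1] card_c[OF wx] n0 by simp
  have e2: "n 2 1 + n 2 2 + n 2 3 = a_num E 2" using row_n[of 2] card_a[OF wx] n0 by simp
  have e3: "n 1 1 + n 2 1 = c_num E 2" using col_n[of 1] card_c[OF wy] n0 by simp
  have e4: "m 1 1 + m 1 2 = c_num E 2" using row_m[of 1] card_c[OF xw] m0 by simp
  have e5: "1 + m 2 1 + m 2 2 = a_num E 2" using row_m[of 2] card_a[OF xw] m0 by simp
  have e6: "m 1 1 + m 2 1 + m 3 1 = a_num E 1" using col_m[of 1] card_a[OF xy] m0 by simp
  have e7: "m 1 1 = n 1 1" unfolding n_def m_def by (rule arg_cong[of _ _ card]) auto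
  have w2: "walks 2 u v = (T (T delta)) (d u v)" for u v by (simp add: walks_def numeral_2_eq_2)
  have t2: "T (T delta) 0 = b 0" "T (T delta) 1 = a 1" "T (T delta) 2 = c 2" "T (T delta) 3 = 0"
    by (simp_all add: T_numerals delta_numerals)
  have s1: "(\<Sum>s | d w s = 1. walks 2 x s * theta (d y s)) =
      a 1 * (n 1 1 * theta 1 + n 1 2 * theta 2) + c 2 * (n 2 1 * theta 1 + n 2 2 * theta 2 + n 2 3 * theta 3)"
  proof -
    have "(\<Sum>s | d w s = 1. walks 2 x s * theta (d y s)) =
        (\<Sum>i\<le>3. \<Sum>j\<le>3. real (n i j) * (T (T delta) i * theta j))"
      unfolding w2 n_def
      using sum_by_levels[of "{s. d w s = 1}" "d x" 3 "d y" 3 "\<lambda>i j. T (T delta) i * theta j"] bn by simp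
    then show ?thesis
      using n0 t2 by (simp add: numeral_3_eq_3 numeral_2_eq_2 algebra_simps)
  qed
  have s2: "(\<Sum>s | d x s = 1. walks 2 w s * theta (d y s)) =
      a 1 * (m 1 1 * theta 1 + m 1 2 * theta 2) + c 2 * (theta 0 + m 2 1 * theta 1 + m 2 2 * theta 2)"
  proof -
    have "(\<Sum>s | d x s = 1. walks 2 w s * theta (d y s)) =
        (\<Sum>i\<le>3. \<Sum>j\<le>2. real (m i j) * (T (T delta) i * theta j))"
      unfolding w2 m_def
      using sum_by_levels[of "{s. d x s = 1}" "d w" 3 "d y" 2 "\<lambda>i j. T (T delta) i * theta j"] bm by simp
    then show ?thesis
      using m0 t2 by (simp add: numeral_3_eq_3 numeral_2_eq_2 algebra_simps)
  qed
  define r where "r = 1 / q"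
  have q: "q \<noteq> 0" "1 + q \<noteq> 0" using q_less by auto
  have qr: "q * r = 1" using q by (simp add: r_def)
  have th: "theta 1 = theta 0 - 1" "theta 2 = theta 0 - 1 - r" "theta 3 = theta 0 - 1 - r - r * r"
    unfolding theta_numerals r_def by simp_all
  have nn: "real (n 1 2) = c 2 - n 1 1" "real (n 2 1) = c 2 - n 1 1" "real (n 2 2) = a 2 - c 2 + n 1 1 - n 2 3"
    "real (m 1 1) = n 1 1" "real (m 1 2) = c 2 - n 1 1" "real (m 2 1) = a 1 - n 1 1 - m 3 1"
    "real (m 2 2) = a 2 - 1 - a 1 + n 1 1 + m 3 1"
    using e1 e2 e3 e4 e5 e6 e7 by linarith+
  \<comment> \<open>Both \<open>n 1 1\<close> and \<open>theta 0\<close> drop out of the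
    difference.\<close>
  have diff: "(\<Sum>s | d w s = 1. walks 2 x s * theta (d y s)) - (\<Sum>s | d x s = 1. walks 2 w s * theta (d y s)) =
      c 2 * (- 1 + (c 2 - a 1 + m 3 1 - 1) * r - n 2 3 * (r * r))"
    unfolding s1 s2 nn th by (simp add: algebra_simps)
  have w3: "walks 3 x w = c 2 * (a 1 + a 2)" "walks 2 x w = c 2" "walks 1 x w = 0"
    unfolding walks_def xw by (simp_all add: funpow_numerals T_numerals delta_numerals algebra_simps)
  define A where "A = N * \<alpha> + \<beta> - \<alpha> * (1 + q) - 1 - \<alpha>"
  have a2: "a 2 = (1 + q) * A" unfolding params A_def ..
  have g: "gam = a 1 + a 2 - coeff * A"
    using q unfolding gam_def a2 by (simp add: add.commute)
  have "(c 2 * (a 1 + a 2) - gam * c 2) * (theta 2 - theta 1) =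
      coeff * (c 2 * (- 1 + (c 2 - a 1 + m 3 1 - 1) * r - n 2 3 * (r * r)))"
    using triple_relation[of x w y] unfolding diff w3 yw yx by simp
  then have "(coeff * c 2) * (- (A * r)) =
      (coeff * c 2) * (- 1 + (c 2 - a 1 + m 3 1 - 1) * r - n 2 3 * (r * r))"
    unfolding g th by (simp add: algebra_simps)
  \<comment> \<open>For \<open>q < -1\<close>, \<open>q * coeff = q * (q + 1) + 1\<close> is
    positive.\<close>
  moreover have "coeff * c 2 \<noteq> 0"
  proof -
    have "coeff \<noteq> 0"
    proof
      assume "coeff = 0"
      then have "coeff * q = 0" by simp
      then have "q\<^sup>2 + q + 1 = 0" using q by (simp add: coeff_def algebra_simps power2_eq_square)
      moreover have "q\<^sup>2 + q + 1 = q * (q + 1) + 1" by (simp add: algebra_simps power2_eq_square)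
      moreover have "q * (q + 1) > 0" using q_less by (intro mult_neg_neg) auto
      ultimately show False by linarith
    qed
    moreover have "c 2 > 0" using c_pos[of 2] diameter diameter_ge by simp
    ultimately show ?thesis by simp
  qed
  ultimately have "- (A * r) = - 1 + (c 2 - a 1 + m 3 1 - 1) * r - n 2 3 * (r * r)"
    using mult_left_cancel by blast
  then have "q * (q * (- (A * r))) = q * (q * (- 1 + (c 2 - a 1 + m 3 1 - 1) * r - n 2 3 * (r * r)))"
    by (rule arg_cong)
  moreover have "q * (q * (- (A * r))) = (q * r) * (- (A * q))" by simp
  moreover have "q * (q * (- 1 + (c 2 - a 1 + m 3 1 - 1) * r - n 2 3 * (r * r))) =
      q * (- q + (c 2 - a 1 + m 3 1 - 1) * (q * r)) - n 2 3 * ((q * r) * (q * r))"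
    by (simp add: algebra_simps)
  ultimately have "- (A * q) = q * (- q + (c 2 - a 1 + m 3 1 - 1)) - n 2 3"
    unfolding qr by simp
  moreover have "A = a 1 + 1 + q - c 2" unfolding A_def params by (simp add: algebra_simps)
  ultimately have "real (n 2 3) = q * m 3 1" by (simp add: algebra_simps)
  then show ?thesis unfolding n_def m_def .
qed

lemma no_kite_counts:
  assumes "d x y = 1" "d x w = 2" "d y w = 2"
  shows "card {s. d w s = 1 \<and> d x s = 2 \<and> d y s = 3} = 0" (is "?n = 0")
    and "card {s. d x s = 1 \<and> d w s = 3 \<and> d y s = 1} = 0" (is "?m = 0")
proof -
  have k: "real ?n = q * real ?m" by (rule kite_balance[OF assms])
  have "q * real ?m \<le> 0" by (rule mult_nonpos_nonneg) (use q_less in simp_all)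
  then have n: "real ?n = 0" using k by linarith
  then show "?n = 0" by (simp only: of_nat_eq_0_iff)
  have "real ?m = 0" using n k q_less by (simp only: mult_eq_0_iff) auto
  then show "?m = 0" by (simp only: of_nat_eq_0_iff)
qed

lemma no_kite:
  assumes "d x y = 1" "d x w = 2" "d y w = 2" "d x s = 1" "d y s = 1"
  shows "d w s \<noteq> 3"
  using no_kite_counts(2)[OF assms(1-3)] assms(4,5) by (auto simp: card_eq_0_iff)

lemma no_raise:
  assumes "d x y = 1" "d x w = 2" "d y w = 2" "d w s = 1" "d x s = 2"
  shows "d y s \<noteq> 3"
  using no_kite_counts(1)[OF assms(1-3)] assms(4,5) by (auto simp: card_eq_0_iff)

text \<open>Step from \<open>z\<close> to a vertex \<open>w\<close> at distance 3 from
  \<open>y\<close>. Then \<open>u\<close>, \<open>v\<close> are adjacent and both at distance 2 from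
  \<open>w\<close>, while their common neighbour \<open>y\<close> is at distance 3, against
  \<open>no_kite\<close>.\<close>

lemma no_K112: "\<not> has_induced_K112 E"
proof
  assume "has_induced_K112 E"
  then obtain u v y z where *: "distinct [u, v, y, z]" "(u, v) \<in> E" "(u, y) \<in> E" "(u, z) \<in> E"
      "(v, y) \<in> E" "(v, z) \<in> E" "(y, z) \<notin> E"
    unfolding has_induced_K112_def by blast
  have e: "d u v = 1" "d u y = 1" "d u z = 1" "d v y = 1" "d v z = 1" and ne: "d y z \<noteq> 1" "d y z \<noteq> 0"
    using * unfolding gdist_eq_1 by auto
  have sy: "d y u = d u y" "d y v = d v y" "d z u = d u z" "d z v = d v z" "d z y = d y z"
    by (rule gdist_sym)+
  have yz: "d y z = 2" using gdist_triangle[of y z u] e sy ne by linarith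
  obtain w where w: "d z w = 1" "d y w = 3"
    using ex_raise[of z y 2] yz sy diameter diameter_ge by auto
  have "d u w = 2" using gdist_triangle[of y w u] gdist_triangle[of u w z] e w sy by linarith
  moreover have "d v w = 2" using gdist_triangle[of y w v] gdist_triangle[of v w z] e w sy by linarith
  ultimately have "d w y \<noteq> 3" using no_kite[of u v w y] e by blast
  then show False using w gdist_sym[of w y] by simp
qed

section \<open>Local counts in the absence of an induced \<open>K112\<close>\<close>

lemma K112D:
  assumes "d u v = 1" "d u y = 1" "d u z = 1" "d v y = 1" "d v z = 1" "y \<noteq> z"
  shows "d y z = 1"
proof (rule ccontr)
  assume "d y z \<noteq> 1"
  moreover have "distinct [u, v, y, z]" using assms by auto
  ultimately have "has_induced_K112 E"
    using assms unfolding has_induced_K112_def gdist_eq_1 by blast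
  then show False using no_K112 by blast
qed

text \<open>The deviation \<open>a i - a 1 * c i\<close> is a constant times the brackets of
  \<open>i\<close> and \<open>i - 1\<close>, whose product at \<open>i = 2\<close> is
  \<open>1 + q\<close>, not 0. Equality at 2 thus spreads to all \<open>i\<close> and, with
  \<open>no_K112\<close>, gives a near polygon.\<close>

lemma a_2_neq:
  assumes "\<not> near_polygon E"
  shows "a_num E 2 \<noteq> a_num E 1 * c_num E 2"
proof
  assume "a_num E 2 = a_num E 1 * c_num E 2"
  then have a2: "a 2 = a 1 * c 2" by simp
  have dev: "a i - a 1 * c i = - (\<alpha> * (1 + q + a 1)) * (qbracket q i * qbracket q (i - 1))"
    if i: "1 \<le> i" "i \<le> D" for i
  proof -
    obtain n where n: "i = Suc n" using i(1) by (cases i) auto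
    define X where "X = qbracket q n"
    have X: "qbracket q i = 1 + q * X" "qbracket q (i - 1) = X" by (simp_all add: n X_def qbracket_Suc)
    have "b i = (N - (1 + q * X)) * (\<beta> - \<alpha> * (1 + q * X))" "c i = (1 + q * X) * (1 + \<alpha> * X)"
      using b_eq[OF i(2)] c_eq[OF i(2)] X by simp_all
    then show ?thesis
      unfolding a_eq[OF i(2)] params X by (simp add: algebra_simps)
  qed
  have "\<alpha> * (1 + q + a 1) = 0"
    using dev[of 2] a2 diameter_ge q_less by (auto simp: qbracket_2)
  then have eq: "a i = a 1 * c i" if "1 \<le> i" "i \<le> D" for i
    using dev[OF that] by (simp only: minus_zero mult_zero_left right_minus_eq)
  have "a_num E i = a_num E 1 * c_num E i" if "1 \<le> i" "i \<le> D - 1" for i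
  proof -
    have "i \<le> D" using that(2) by simp
    with that(1) have "real (a_num E i) = real (a_num E 1 * c_num E i)"
      unfolding of_nat_mult by (rule eq)
    then show ?thesis by (rule of_nat_eq_iff[THEN iffD1])
  qed
  then show False
    using assms drg no_K112 unfolding near_polygon_def diameter by blast
qed

text \<open>Positivity of \<open>c 2\<close> with \<open>1 + q < 0\<close> forces
  \<open>1 + \<alpha> < 0\<close>, so \<alpha> and \<open>q\<close> are both negative and
  \<open>c 3 - c 2\<close> is a positive plus a nonnegative term.\<close>

lemma c2_less_c3: "c_num E 2 < c_num E 3"
proof -
  have "c 2 > 0" using c_pos[of 2] diameter diameter_ge by simp
  then have "\<alpha> < 0" using q_less unfolding params by (simp add: zero_less_mult_iff)
  then have "\<alpha> * q > 0" using q_less by (intro mult_neg_neg) auto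
  then have "\<alpha> * q * (1 + q)\<^sup>2 \<ge> 0" by simp
  moreover have "c 3 - c 2 = q\<^sup>2 + \<alpha> * q * (1 + q)\<^sup>2"
    unfolding params by (simp add: algebra_simps power2_eq_square)
  moreover have "q\<^sup>2 > 0" using q_less by simp
  ultimately have "c 3 > c 2" by linarith
  then show ?thesis by simp
qed

text \<open>Comparing the valency at distances 1 and 2; this later keeps the coefficient
  \<open>b 1 - c 2 + 1\<close> away from 0.\<close>

lemma c2_le_b1: "a_num E 1 = 0 \<Longrightarrow> c_num E 2 \<le> b_num E 1"
proof -
  assume "a_num E 1 = 0"
  then have "c 2 + a 2 + b 2 = 1 + b 1"
    using valency[of 1] valency[of 2] c1 diameter diameter_ge by simp
  moreover have "b 2 > 0" using b_pos[of 2] diameter diameter_ge by simp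
  ultimately have "c 2 < 1 + b 1" by linarith
  then show ?thesis by simp
qed

text \<open>Two such vertices would be adjacent, being common neighbours of the edge
  \<open>x y\<close>; then \<open>x\<close> and \<open>w\<close>, common neighbours of the edge
  between them, would be adjacent too.\<close>

lemma common_neighbours_le_1:
  assumes "d x w = 2" "d x y = 1"
  shows "card {s. d x s = 1 \<and> d w s = 1 \<and> d y s = 1} \<le> 1"
proof -
  have "s = s'" if s: "d x s = 1" "d w s = 1" "d y s = 1" and s': "d x s' = 1" "d w s' = 1" "d y s' = 1" for s s'
  proof (rule ccontr)
    assume "s \<noteq> s'"
    then have "d s s' = 1" using K112D[of x y s s'] s s' assms by simp
    moreover have "x \<noteq> w" using assms by auto
    moreover have "d s x = 1" "d s w = 1" "d s' x = 1" "d s' w = 1"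
      using s s' gdist_sym[of s x] gdist_sym[of s w] gdist_sym[of s' x] gdist_sym[of s' w] by simp_all
    ultimately have "d x w = 1" using K112D[of s s' x w] by blast
    then show False using assms by simp
  qed
  then show ?thesis by (simp add: card_le_Suc0_iff_eq)
qed

text \<open>Double counting: each of the \<open>c 2\<close> common neighbours \<open>s\<close> of
  \<open>x\<close> and \<open>w\<close> has \<open>a 1\<close> common neighbours with
  \<open>x\<close>, and \<open>K112D\<close> puts all of them at distance 2 from
  \<open>w\<close>.\<close>

lemma sum_common_neighbours:
  assumes xw: "d x w = 2"
  shows "(\<Sum>y | d x y = 1 \<and> d w y = 2. card {s. d x s = 1 \<and> d w s = 1 \<and> d y s = 1}) = a_num E 1 * c_num E 2"
proof -
  define Y where "Y = {y. d x y = 1 \<and> d w y = 2}"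
  define S where "S = {s. d x s = 1 \<and> d w s = 1}"
  have fin: "finite Y" "finite S" by simp_all
  have "(\<Sum>y\<in>Y. card {s. d x s = 1 \<and> d w s = 1 \<and> d y s = 1}) = (\<Sum>y\<in>Y. card {s \<in> S. d y s = 1})"
    by (simp add: S_def conj_assoc)
  also have "\<dots> = (\<Sum>y\<in>Y. \<Sum>s\<in>S. if d y s = 1 then 1 else 0)"
    by (simp add: sum.If_cases Int_def)
  also have "\<dots> = (\<Sum>s\<in>S. \<Sum>y\<in>Y. if d y s = 1 then 1 else 0)"
    by (rule sum.swap)
  also have "\<dots> = (\<Sum>s\<in>S. card {y \<in> Y. d y s = 1})"
    by (simp add: sum.If_cases Int_def)
  also have "\<dots> = (\<Sum>s\<in>S. a_num E 1)"
  proof (rule sum.cong)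
    fix s assume "s \<in> S"
    then have s: "d x s = 1" "d w s = 1" by (auto simp: S_def)
    have "d w y = 2" if y: "d x y = 1" "d s y = 1" for y
    proof -
      have "d w y \<noteq> 0" using y xw by auto
      moreover have "d w y \<noteq> 1"
      proof
        assume "d w y = 1"
        moreover have "x \<noteq> w" using xw by auto
        ultimately have "d x w = 1"
          using K112D[of s y x w] s y gdist_sym[of s x] gdist_sym[of s w] gdist_sym[of y x] gdist_sym[of y w]
          by simp
        then show False using xw by simp
      qed
      moreover have "d w y \<le> 2" using gdist_triangle[of w y s] s y by linarith
      ultimately show ?thesis by linarith
    qed
    then have "{y \<in> Y. d y s = 1} = {y. d x y = 1 \<and> d s y = 1}"
      by (auto simp: Y_def gdist_sym[of _ s])
    then show "card {y \<in> Y. d y s = 1} = a_num E 1" using card_a[OF s(1)] by simp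
  qed simp
  also have "\<dots> = a_num E 1 * c_num E 2"
    using card_c[OF xw] by (simp add: S_def)
  finally show ?thesis by (simp add: Y_def)
qed

text \<open>There are \<open>a 2\<close> candidates; if each had exactly one such neighbour, the
  double count would read \<open>a 2 = a 1 * c 2\<close>.\<close>

lemma ex_no_common_neighbour:
  assumes "\<not> near_polygon E" and xw: "d x w = 2"
  obtains y where "d x y = 1" "d y w = 2" "card {s. d x s = 1 \<and> d w s = 1 \<and> d y s = 1} = 0"
proof (rule ccontr)
  note witness = that
  assume none: "\<not> thesis"
  have "card {s. d x s = 1 \<and> d w s = 1 \<and> d y s = 1} = 1" if y: "d x y = 1 \<and> d w y = 2" for y
  proof -
    have "card {s. d x s = 1 \<and> d w s = 1 \<and> d y s = 1} \<noteq> 0"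
    proof
      assume "card {s. d x s = 1 \<and> d w s = 1 \<and> d y s = 1} = 0"
      then have thesis using witness[of y] y gdist_sym[of y w] by simp
      then show False using none by simp
    qed
    then show ?thesis using common_neighbours_le_1[OF xw conjunct1[OF y]] by linarith
  qed
  then have "(\<Sum>y | d x y = 1 \<and> d w y = 2. card {s. d x s = 1 \<and> d w s = 1 \<and> d y s = 1}) =
      card {y. d x y = 1 \<and> d w y = 2}"
    by simp
  then show False
    unfolding sum_common_neighbours[OF xw] card_a[OF xw] using a_2_neq[OF assms(1)] by simp
qed

lemma ex_common_neighbour:
  assumes "a_num E 1 > 0" and xw: "d x w = 2"
  obtains y where "d x y = 1" "d y w = 2" "card {s. d x s = 1 \<and> d w s = 1 \<and> d y s = 1} = 1"
proof -
  have "a_num E 1 * c_num E 2 \<noteq> 0" using assms(1) c_pos[of 2] diameter diameter_ge by simp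
  then have "(\<Sum>y | d x y = 1 \<and> d w y = 2. card {s. d x s = 1 \<and> d w s = 1 \<and> d y s = 1}) \<noteq> 0"
    unfolding sum_common_neighbours[OF xw] .
  then obtain y where y: "y \<in> {y. d x y = 1 \<and> d w y = 2}" "card {s. d x s = 1 \<and> d w s = 1 \<and> d y s = 1} \<noteq> 0"
    by (rule sum.not_neutral_contains_not_neutral)
  then have "card {s. d x s = 1 \<and> d w s = 1 \<and> d y s = 1} = 1"
    using common_neighbours_le_1[OF xw, of y] by (simp only: mem_Collect_eq) linarith
  with y show ?thesis using that[of y] gdist_sym[of w y] by simp
qed

text \<open>Of the \<open>c 3\<close> neighbours of \<open>w\<close> closer to \<open>y\<close>,
  none is at distance 2 from \<open>x\<close> by \<open>no_raise\<close>, and those at distance 1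
  are the \<open>c 2\<close> common neighbours of \<open>x\<close> and \<open>w\<close>. The next
  two lemmas treat \<open>d y w = 2\<close> and \<open>d y w = 1\<close>.\<close>

lemma card_raise_3:
  assumes "d x y = 1" "d x w = 2" "d y w = 3"
  shows "card {u. d w u = 1 \<and> d x u = 3 \<and> d y u = 2} = c_num E 3 - c_num E 2"
proof -
  have sy: "d w x = 2" "d w y = 3" "d y x = 1" using assms by (simp_all add: gdist_sym)
  have cases: "d x u = 1 \<or> d x u = 3" if "d w u = 1" "d y u = 2" for u
  proof -
    have "d x u \<noteq> 2"
      using no_raise[of x y u w] assms that gdist_sym[of u w] by auto
    moreover have "d x u \<ge> 1" "d x u \<le> 3"
      using gdist_triangle[of x w u] gdist_triangle[of x u y] gdist_sym[of u w] assms that by linarith+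
    ultimately show ?thesis by linarith
  qed
  have two: "d y u = 2" if "d w u = 1" "d x u = 1" for u
    using gdist_triangle[of y w u] gdist_triangle[of y u x] gdist_sym[of u w] assms sy that by linarith
  have "{u. d w u = 1 \<and> d y u = 2} = {u. d w u = 1 \<and> d x u = 1} \<union> {u. d w u = 1 \<and> d x u = 3 \<and> d y u = 2}"
    using cases two by blast
  moreover have "{u. d w u = 1 \<and> d x u = 1} \<inter> {u. d w u = 1 \<and> d x u = 3 \<and> d y u = 2} = {}" by auto
  ultimately have "card {u. d w u = 1 \<and> d y u = 2} =
      card {u. d w u = 1 \<and> d x u = 1} + card {u. d w u = 1 \<and> d x u = 3 \<and> d y u = 2}"
    by (simp add: card_Un_disjoint)
  then show ?thesis using card_c[OF sy(1)] card_c[OF sy(2)] by simp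
qed

lemma card_raise_2:
  assumes "d x y = 1" "d x w = 2" "d y w = 2"
  shows "{u. d w u = 1 \<and> d x u = 3 \<and> d y u = 2} = {}"
  using no_raise[of y x w] assms gdist_sym[of y x] by auto

lemma card_raise_1:
  assumes "d x y = 1" "d x w = 2" "d y w = 1"
  shows "card {u. d w u = 1 \<and> d x u = 3 \<and> d y u = 2} = b_num E 2"
proof -
  have "d y u = 2" if "d w u = 1" "d x u = 3" for u
    using gdist_triangle[of x u y] gdist_triangle[of y u w] assms that by linarith
  then have "{u. d w u = 1 \<and> d x u = 3 \<and> d y u = 2} = {u. d w u = 1 \<and> d x u = 2 + 1}" by auto
  then show ?thesis using card_b[of w x 2] assms(2) gdist_sym[of w x] by simp
qed

text \<open>Among the \<open>c 2\<close> common neighbours of \<open>y\<close> and \<open>s\<close>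
  is \<open>x\<close>; another one adjacent to \<open>x\<close> would create an induced
  \<open>K112\<close>. With the next two lemmas this gives the entries of \<open>L ** R\<close> on
  level 1.\<close>

lemma card_upper_common_2:
  assumes "d x y = 1" "d x s = 1" "d y s = 2"
  shows "card {t. d y t = 1 \<and> d s t = 1 \<and> d x t = 2} = c_num E 2 - 1"
proof -
  have sx: "d y x = 1" "d s x = 1" using assms by (simp_all add: gdist_sym)
  have "d x t = 2" if t: "d y t = 1" "d s t = 1" "t \<noteq> x" for t
  proof -
    have "y \<noteq> s" using assms by auto
    moreover have "d t y = 1" "d t s = 1" using t gdist_sym[of t y] gdist_sym[of t s] by simp_all
    ultimately have "d x t \<noteq> 1" using K112D[OF _ assms(1,2), of t] assms(3) by auto
    moreover have "d x t \<noteq> 0" using t by simp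
    moreover have "d x t \<le> 2" using gdist_triangle[of x t y] assms t by linarith
    ultimately show ?thesis by linarith
  qed
  then have "{t. d y t = 1 \<and> d s t = 1} = insert x {t. d y t = 1 \<and> d s t = 1 \<and> d x t = 2}"
    using sx by auto
  then have "c_num E 2 = Suc (card {t. d y t = 1 \<and> d s t = 1 \<and> d x t = 2})"
    using card_c[OF assms(3)] by simp
  then show ?thesis by simp
qed

lemma card_upper_common_1:
  assumes "d x y = 1" "d x s = 1" "d y s = 1"
  shows "{t. d y t = 1 \<and> d s t = 1 \<and> d x t = 2} = {}"
proof -
  have False if t: "d y t = 1" "d s t = 1" "d x t = 2" for t
  proof -
    have "t \<noteq> x" using t by auto
    then have "d t x = 1" using K112D[of y s t x] assms t gdist_sym[of y x] gdist_sym[of s x] by simp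
    then show False using t gdist_sym[of t x] by simp
  qed
  then show ?thesis by auto
qed

lemma card_upper_common_0:
  assumes "d x y = 1"
  shows "card {t. d y t = 1 \<and> d y t = 1 \<and> d x t = 2} = b_num E 1"
proof -
  have "d y x = 1" using assms gdist_sym[of y x] by simp
  then show ?thesis using card_b[of y x 1] by (simp add: numeral_2_eq_2)
qed

end

section \<open>Uniform structures\<close>

abbreviation entry :: "complex^'m^'n \<Rightarrow> 'n \<Rightarrow> 'm \<Rightarrow> complex" where
  "entry M y z \<equiv> vec_nth (vec_nth M y) z"

lemma entry_mult: "entry (M ** P) y z = (\<Sum>k\<in>UNIV. entry M y k * entry P k z)"
  by (simp add: matrix_matrix_mult_def)

text \<open>The relation is assumed only where \<open>P\<close> is nonzero, since a uniform relation
  is available on a single level.\<close>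

lemma linear_relation_mult_right:
  assumes "\<And>u. entry P u z \<noteq> 0 \<Longrightarrow> e * entry M\<^sub>1 y u + entry M\<^sub>2 y u + g * entry M\<^sub>3 y u = f * entry M\<^sub>4 y u"
  shows "e * entry (M\<^sub>1 ** P) y z + entry (M\<^sub>2 ** P) y z + g * entry (M\<^sub>3 ** P) y z = f * entry (M\<^sub>4 ** P) y z"
proof -
  have "e * entry (M\<^sub>1 ** P) y z + entry (M\<^sub>2 ** P) y z + g * entry (M\<^sub>3 ** P) y z =
      (\<Sum>u\<in>UNIV. (e * entry M\<^sub>1 y u + entry M\<^sub>2 y u + g * entry M\<^sub>3 y u) * entry P u z)"
    unfolding entry_mult by (simp add: sum_distrib_left sum.distrib algebra_simps)
  also have "\<dots> = (\<Sum>u\<in>UNIV. f * entry M\<^sub>4 y u * entry P u z)"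
    by (rule sum.cong) (use assms in auto)
  also have "\<dots> = f * entry (M\<^sub>4 ** P) y z"
    unfolding entry_mult by (simp add: sum_distrib_left mult.assoc)
  finally show ?thesis .
qed

lemma linear_relation_mult_left:
  assumes "\<And>u. entry P y u \<noteq> 0 \<Longrightarrow> e * entry M\<^sub>1 u z + entry M\<^sub>2 u z + g * entry M\<^sub>3 u z = f * entry M\<^sub>4 u z"
  shows "e * entry (P ** M\<^sub>1) y z + entry (P ** M\<^sub>2) y z + g * entry (P ** M\<^sub>3) y z = f * entry (P ** M\<^sub>4) y z"
proof -
  have "e * entry (P ** M\<^sub>1) y z + entry (P ** M\<^sub>2) y z + g * entry (P ** M\<^sub>3) y z =
      (\<Sum>u\<in>UNIV. entry P y u * (e * entry M\<^sub>1 u z + entry M\<^sub>2 u z + g * entry M\<^sub>3 u z))"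
    unfolding entry_mult by (simp add: sum_distrib_left sum.distrib algebra_simps)
  also have "\<dots> = (\<Sum>u\<in>UNIV. entry P y u * (f * entry M\<^sub>4 u z))"
    by (rule sum.cong) (use assms in auto)
  also have "\<dots> = f * entry (P ** M\<^sub>4) y z"
    unfolding entry_mult by (simp add: sum_distrib_left mult_ac)
  finally show ?thesis .
qed

lemma sum_filtered:
  fixes g :: "'v::finite \<Rightarrow> complex"
  assumes "\<And>k. h k = (if P k then g k else 0)"
  shows "(\<Sum>k\<in>UNIV. h k) = (\<Sum>k | P k. g k)"
  unfolding assms by (simp add: sum.If_cases)

locale rooted_classical = classical_negative E D q \<alpha> \<beta>
  for E :: "('v::finite \<times> 'v) set" and D q \<alpha> \<beta> + fixes x :: 'v
begin

section \<open>Entries of products of \<open>L\<close> and \<open>R\<close>\<close>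

abbreviation L where "L \<equiv> lowering_matrix E x"
abbreviation R where "R \<equiv> raising_matrix E x"

lemma entry_sum: "finite I \<Longrightarrow> entry (\<Sum>i\<in>I. M i) y z = (\<Sum>i\<in>I. entry (M i) y z)"
  by (simp add: sum_component)

lemma entry_adj: "entry (adj_matrix E) y z = (if d y z = 1 then 1 else 0)"
  by (simp add: adj_matrix_def gdist_eq_1[unfolded One_nat_def])

lemma entry_L: "entry L y z = (if d y z = 1 \<and> d x z = d x y + 1 then 1 else 0)"
proof -
  have "entry L y z = (\<Sum>i = 1..D. if i = d x z then (if d x y = i - 1 then entry (adj_matrix E) y z else 0) else 0)"
    unfolding lowering_matrix_def entry_sum[OF finite_atLeastAtMost] dual_idem_sandwich eccentricity_eq diameter
    by (rule sum.cong) auto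
  also have "\<dots> = (if 1 \<le> d x z \<and> d x y = d x z - 1 then entry (adj_matrix E) y z else 0)"
    using gdist_le_diameter[of x z] diameter by (subst sum.delta) auto
  finally show ?thesis unfolding entry_adj by auto
qed

lemma entry_R: "entry R y z = entry L z y"
proof -
  have "entry R y z = (\<Sum>i<D. if i = d x z then (if d x y = i + 1 then entry (adj_matrix E) y z else 0) else 0)"
    unfolding raising_matrix_def entry_sum[OF finite_lessThan] dual_idem_sandwich eccentricity_eq diameter
    by (rule sum.cong) auto
  also have "\<dots> = (if d x z < D \<and> d x y = d x z + 1 then entry (adj_matrix E) y z else 0)"
    by (subst sum.delta) auto
  finally show ?thesis
    unfolding entry_adj entry_L gdist_sym[of y z] using gdist_le_diameter[of x y] diameter by auto
qed

lemma R_transpose: "R = transpose L"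
  by (simp add: Finite_Cartesian_Product.vec_eq_iff transpose_def entry_R)

text \<open>A common neighbour of vertices two levels apart lies on the level between them, so all
  \<open>c 2\<close> of them count.\<close>

lemma entry_LL: "entry (L ** L) y w = (if d x w = d x y + 2 \<and> d y w = 2 then of_nat (c_num E 2) else 0)"
proof -
  have "entry (L ** L) y w = (\<Sum>t | d y t = 1 \<and> d t w = 1 \<and> d x t = d x y + 1 \<and> d x w = d x y + 2. 1)"
    unfolding entry_mult by (rule sum_filtered) (auto simp: entry_L)
  also have "\<dots> = (if d x w = d x y + 2 \<and> d y w = 2 then of_nat (c_num E 2) else 0)"
  proof (cases "d x w = d x y + 2 \<and> d y w = 2")
    case True
    then have "{t. d y t = 1 \<and> d t w = 1 \<and> d x t = d x y + 1 \<and> d x w = d x y + 2} = {t. d y t = 1 \<and> d w t = 1}"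
    proof -
      have "d x t = d x y + 1" if "d y t = 1" "d w t = 1" for t
        using that True gdist_triangle[of x t y] gdist_triangle[of x w t] gdist_sym[of t w] by linarith
      then show ?thesis using True by (auto simp: gdist_sym[of _ w])
    qed
    then show ?thesis using True card_c[of y w 2] by simp
  next
    case False
    have "d y w = 2" if "d y t = 1" "d t w = 1" "d x w = d x y + 2" for t
      using that gdist_triangle[of y w t] gdist_triangle[of x w y] by linarith
    then have "{t. d y t = 1 \<and> d t w = 1 \<and> d x t = d x y + 1 \<and> d x w = d x y + 2} = {}"
      using False by blast
    then show ?thesis using False by (simp only: sum.empty if_False)
  qed
  finally show ?thesis .
qed

lemma entry_RR: "entry (R ** R) y w = entry (L ** L) w y"
  unfolding R_transpose matrix_transpose_mul[symmetric] by (simp add: transpose_def)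

lemma entry_RLL:
  assumes "d x y = 1"
  shows "entry (R ** L ** L) y w = (if d x w = 2 then of_nat (c_num E 2) else 0)"
proof -
  have "entry (R ** L ** L) y w = (\<Sum>k | k = x. entry (L ** L) k w)"
    unfolding matrix_mul_assoc[symmetric] entry_mult[of R]
    by (rule sum_filtered) (use assms in \<open>auto simp: entry_R entry_L\<close>)
  then show ?thesis by (simp add: entry_LL)
qed

lemma entry_LR:
  assumes "d x y = 1" "d x s = 1"
  shows "entry (L ** R) y s =
    (if d y s = 0 then of_nat (b_num E 1) else if d y s = 1 then 0 else of_nat (c_num E 2) - 1)"
proof -
  have "entry (L ** R) y s = (\<Sum>t | d y t = 1 \<and> d s t = 1 \<and> d x t = 2. 1)"
    unfolding entry_mult by (rule sum_filtered) (use assms in \<open>auto simp: entry_R entry_L\<close>)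
  also have "\<dots> = of_nat (card {t. d y t = 1 \<and> d s t = 1 \<and> d x t = 2})" by simp
  finally have e: "entry (L ** R) y s = of_nat (card {t. d y t = 1 \<and> d s t = 1 \<and> d x t = 2})" .
  have "d y s \<le> 2" using gdist_triangle[of y s x] gdist_sym[of y x] assms by simp
  then consider "d y s = 0" | "d y s = 1" | "d y s = 2" by linarith
  then show ?thesis
  proof cases
    case 1
    then have "y = s" by simp
    then show ?thesis using e card_upper_common_0[OF assms(1)] by simp
  next
    case 2
    then show ?thesis unfolding e card_upper_common_1[OF assms 2] by simp
  next
    case 3
    have "c_num E 2 \<ge> 1" using c_pos[of 2] diameter diameter_ge by simp
    then show ?thesis unfolding e card_upper_common_2[OF assms 3] using 3 by (simp add: of_nat_diff)
  qed
qed

text \<open>The middle vertices are the common neighbours \<open>s\<close> of \<open>x\<close> and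
  \<open>w\<close>. The assumption \<open>yw\<close> keeps \<open>s\<close> different from
  \<open>y\<close>; then \<open>s\<close> contributes 0 if adjacent to \<open>y\<close>, and
  \<open>c 2 - 1\<close> otherwise.\<close>

lemma entry_LRL:
  assumes y: "d x y = 1" and w: "d x w = 2" and yw: "d y w \<noteq> 1"
  shows "entry (L ** R ** L) y w = (of_nat (c_num E 2) - of_nat (card {s. d x s = 1 \<and> d w s = 1 \<and> d y s = 1})) *
    (of_nat (c_num E 2) - 1)"
proof -
  have "entry (L ** R ** L) y w = (\<Sum>s | d x s = 1 \<and> d w s = 1. entry (L ** R) y s)"
    unfolding entry_mult[of "L ** R"]
    by (rule sum_filtered) (use w in \<open>auto simp: entry_L gdist_sym[of w]\<close>)
  also have "\<dots> = (\<Sum>s | d x s = 1 \<and> d w s = 1. (of_nat (c_num E 2) - 1) -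
      (if d y s = 1 then of_nat (c_num E 2) - 1 else 0))"
  proof (rule sum.cong)
    fix s assume "s \<in> {s. d x s = 1 \<and> d w s = 1}"
    then have s: "d x s = 1" "d w s = 1" by auto
    then have "d y s \<noteq> 0" using yw gdist_sym[of y w] by auto
    then show "entry (L ** R) y s = (of_nat (c_num E 2) - 1) - (if d y s = 1 then of_nat (c_num E 2) - 1 else 0)"
      unfolding entry_LR[OF y s(1)] by simp
  qed simp
  also have "\<dots> = of_nat (c_num E 2) * (of_nat (c_num E 2) - 1) -
      of_nat (card {s. d x s = 1 \<and> d w s = 1 \<and> d y s = 1}) * (of_nat (c_num E 2) - 1)"
    using card_c[OF w] by (simp add: sum_subtractf sum.If_cases Collect_conj_eq[symmetric] conj_assoc)
  finally show ?thesis by (simp add: algebra_simps)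
qed

lemma entry_LRR:
  assumes w: "d x w = 2"
  shows "entry (L ** R ** R) w y =
    (if d x y = 1 then of_nat (c_num E 2) * of_nat (card {u. d w u = 1 \<and> d x u = 3 \<and> d y u = 2}) else 0)"
proof -
  have "entry (L ** R ** R) w y = (\<Sum>u | d w u = 1 \<and> d x u = 3 \<and> d y u = 2 \<and> d x y = 1. of_nat (c_num E 2))"
    unfolding matrix_mul_assoc[symmetric] entry_mult[of L]
    by (rule sum_filtered) (use w in \<open>auto simp: entry_RR entry_LL entry_L\<close>)
  then show ?thesis by (simp add: mult.commute)
qed

lemma entry_LLR:
  assumes y: "d x y = 1" and w: "d x w = 2"
  shows "entry (L ** L ** R) y w =
    of_nat (c_num E 2) * of_nat (card {u. d w u = 1 \<and> d x u = 3 \<and> d y u = 2})"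
proof -
  have "L ** L ** R = transpose (L ** R ** R)"
    unfolding R_transpose by (simp add: matrix_transpose_mul matrix_mul_assoc)
  then have "entry (L ** L ** R) y w = entry (L ** R ** R) w y" by (simp add: transpose_def)
  then show ?thesis using entry_LRR[OF w, of y] y by simp
qed

lemma uniform_entry:
  assumes "\<forall>v\<in>range (\<lambda>w. dual_idem E x i *v w). e *s ((R ** L ** L) *v v) + (L ** R ** L) *v v
             + g *s ((L ** L ** R) *v v) = f *s (L *v v)"
    and w: "d x w = i"
  shows "e * entry (R ** L ** L) y w + entry (L ** R ** L) y w + g * entry (L ** L ** R) y w = f * entry L y w"
proof -
  have col: "vec_nth (M *v axis w 1) k = entry M k w" for M :: "complex^'v^'v" and k
    by (simp add: matrix_vector_mult_def axis_def if_distrib cong: if_cong)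
  have "dual_idem E x i *v axis w 1 = axis w 1"
    unfolding Finite_Cartesian_Product.vec_eq_iff col using w by (simp add: dual_idem_def axis_def)
  then have "axis w 1 \<in> range (\<lambda>w. dual_idem E x i *v w)" by (metis rangeI)
  from bspec[OF assms(1) this]
  have "vec_nth (e *s ((R ** L ** L) *v axis w 1) + (L ** R ** L) *v axis w 1
             + g *s ((L ** L ** R) *v axis w 1)) y = vec_nth (f *s (L *v axis w 1)) y"
    by (rule arg_cong)
  then show ?thesis by (simp add: col)
qed

text \<open>As \<open>a 1 = 0\<close>, \<open>t\<close> and \<open>y\<close> are at distance 2. The
  upper neighbours \<open>w\<close> of \<open>t\<close> are split by their distance to
  \<open>y\<close>: distances 1 and 3 occur \<open>c 2 - 1\<close> and \<open>b 2\<close> times,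
  distance 2 contributes 0. The value is the same for all such \<open>t\<close> and
  \<open>y\<close>.\<close>

lemma entry_LLRR:
  assumes a1: "a_num E 1 = 0" and t: "d x t = 1" and y: "d x y = 1" and ty: "t \<noteq> y"
  shows "entry (L ** L ** R ** R) t y = of_nat (c_num E 2 - 1) * (of_nat (c_num E 2) * of_nat (b_num E 2)) +
    of_nat (b_num E 2) * (of_nat (c_num E 2) * of_nat (c_num E 3 - c_num E 2))"
proof -
  have xt: "d t x = 1" and yx: "d y x = 1" using t y gdist_sym[of t x] gdist_sym[of y x] by simp_all
  have "d y t \<noteq> 1"
  proof
    assume "d y t = 1"
    then have "t \<in> {w. d y w = 1 \<and> d x w = 1}" using t by simp
    then show False using card_a[OF yx] a1 by auto
  qed
  moreover have "d y t \<noteq> 0" "d y t \<le> 2" using ty gdist_triangle[of y t x] yx t by auto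
  ultimately have yt: "d y t = 2" by linarith
  have ty2: "d t y = 2" using yt gdist_sym[of t y] by simp
  have "entry (L ** L ** R ** R) t y = (\<Sum>w | d t w = 1 \<and> d x w = 2. entry (L ** R ** R) w y)"
    unfolding matrix_mul_assoc[symmetric] entry_mult[of L]
    by (rule sum_filtered) (use t in \<open>auto simp: entry_L\<close>)
  also have "\<dots> = (\<Sum>w | d t w = 1 \<and> d x w = 2.
      (if d y w = 1 then of_nat (c_num E 2) * of_nat (b_num E 2) else 0) +
      (if d y w = 3 then of_nat (c_num E 2) * of_nat (c_num E 3 - c_num E 2) else 0))"
  proof (rule sum.cong)
    fix w assume "w \<in> {w. d t w = 1 \<and> d x w = 2}"
    then have w: "d t w = 1" "d x w = 2" by auto
    have "1 \<le> d y w" "d y w \<le> 3"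
      using gdist_triangle[of y w x] gdist_triangle[of x w y] w y yx by linarith+
    then consider "d y w = 1" | "d y w = 2" | "d y w = 3" by linarith
    then show "entry (L ** R ** R) w y = (if d y w = 1 then of_nat (c_num E 2) * of_nat (b_num E 2) else 0) +
      (if d y w = 3 then of_nat (c_num E 2) * of_nat (c_num E 3 - c_num E 2) else 0)"
    proof cases
      case 1
      then show ?thesis unfolding entry_LRR[OF w(2)] card_raise_1[OF y w(2) 1] using y by simp
    next
      case 2
      then show ?thesis unfolding entry_LRR[OF w(2)] card_raise_2[OF y w(2) 2] using y by simp
    next
      case 3
      then show ?thesis unfolding entry_LRR[OF w(2)] card_raise_3[OF y w(2) 3] using y by simp
    qed
  qed simp
  also have "\<dots> = of_nat (card {w. d t w = 1 \<and> d x w = 2 \<and> d y w = 1}) * (of_nat (c_num E 2) * of_nat (b_num E 2)) +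
      of_nat (card {w. d t w = 1 \<and> d x w = 2 \<and> d y w = 3}) * (of_nat (c_num E 2) * of_nat (c_num E 3 - c_num E 2))"
    unfolding sum.distrib by (simp add: sum.If_cases Collect_conj_eq[symmetric] conj_assoc)
  also have "{w. d t w = 1 \<and> d x w = 2 \<and> d y w = 1} = {w. d y w = 1 \<and> d t w = 1 \<and> d x w = 2}" by auto
  also have "{w. d t w = 1 \<and> d x w = 2 \<and> d y w = 3} = {w. d t w = 1 \<and> d y w = 2 + 1}"
  proof -
    have "d x w = 2" if "d t w = 1" "d y w = 3" for w
      using gdist_triangle[of y w x] gdist_triangle[of x w t] yx t that by linarith
    then show ?thesis by auto
  qed
  finally show ?thesis
    unfolding card_b[OF ty2] card_upper_common_2[OF y t yt] .
qed

text \<open>Since \<open>w\<close> and \<open>y\<close> are not adjacent, every \<open>t\<close>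
  below \<open>w\<close> differs from \<open>y\<close> and \<open>entry_LLRR\<close> applies; the
  value does not distinguish distances 2 and 3.\<close>

lemma RLLRR_entry:
  assumes a1: "a_num E 1 = 0" and w: "d x w = 2" and y: "d x y = 1" and wy: "d w y \<noteq> 1"
  shows "entry (R ** L ** L ** R ** R) w y = of_nat (c_num E 2) *
    (of_nat (c_num E 2 - 1) * (of_nat (c_num E 2) * of_nat (b_num E 2)) +
    of_nat (b_num E 2) * (of_nat (c_num E 2) * of_nat (c_num E 3 - c_num E 2)))"
proof -
  have "R ** L ** L ** R ** R = R ** (L ** L ** R ** R)" by (simp only: matrix_mul_assoc)
  also have "entry \<dots> w y = (\<Sum>t | d x t = 1 \<and> d w t = 1. entry (L ** L ** R ** R) t y)"
    unfolding entry_mult[of R]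
    by (rule sum_filtered) (use w in \<open>auto simp: entry_R entry_L gdist_sym[of w]\<close>)
  also have "\<dots> = (\<Sum>t | d x t = 1 \<and> d w t = 1. of_nat (c_num E 2 - 1) * (of_nat (c_num E 2) * of_nat (b_num E 2)) +
    of_nat (b_num E 2) * (of_nat (c_num E 2) * of_nat (c_num E 3 - c_num E 2)))"
  proof (rule sum.cong)
    fix t assume "t \<in> {t. d x t = 1 \<and> d w t = 1}"
    then have t: "d x t = 1" "t \<noteq> y" using wy by auto
    show "entry (L ** L ** R ** R) t y = of_nat (c_num E 2 - 1) * (of_nat (c_num E 2) * of_nat (b_num E 2)) +
      of_nat (b_num E 2) * (of_nat (c_num E 2) * of_nat (c_num E 3 - c_num E 2))"
      by (rule entry_LLRR[OF a1 t(1) y t(2)])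
  qed simp
  finally show ?thesis using card_c[OF w] by simp
qed

text \<open>With \<open>a 1 = 0\<close>, \<open>L ** R\<close> on level 1 is
  \<open>(b 1 - c 2 + 1) I + (c 2 - 1) J\<close>, where \<open>J\<close> is the all-ones matrix; so
  the second summand is independent of \<open>y\<close>.\<close>

lemma LRRLR_entry:
  assumes a1: "a_num E 1 = 0" and w: "d x w = 2" and y: "d x y = 1"
  shows "entry (L ** R ** R ** L ** R) w y =
    (of_nat (b_num E 1) - of_nat (c_num E 2) + 1) * entry (L ** R ** R) w y +
    (of_nat (c_num E 2) - 1) * (\<Sum>t\<in>UNIV. entry (L ** R ** R) w t)"
proof -
  have yx: "d y x = 1" using y gdist_sym[of y x] by simp
  have "L ** R ** R ** L ** R = (L ** R ** R) ** (L ** R)" by (simp only: matrix_mul_assoc)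
  then have "entry (L ** R ** R ** L ** R) w y = (\<Sum>t\<in>UNIV. entry (L ** R ** R) w t * entry (L ** R) t y)"
    by (simp only: entry_mult[of "L ** R ** R"])
  also have "\<dots> = (\<Sum>t\<in>UNIV. (if t = y then (of_nat (b_num E 1) - of_nat (c_num E 2) + 1) * entry (L ** R ** R) w y else 0) +
      (of_nat (c_num E 2) - 1) * entry (L ** R ** R) w t)"
  proof (rule sum.cong)
    fix t
    show "entry (L ** R ** R) w t * entry (L ** R) t y =
      (if t = y then (of_nat (b_num E 1) - of_nat (c_num E 2) + 1) * entry (L ** R ** R) w y else 0) +
      (of_nat (c_num E 2) - 1) * entry (L ** R ** R) w t"
    proof (cases "d x t = 1")
      case False
      then show ?thesis using y by (auto simp: entry_LRR[OF w])
    next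
      case True
      have "d t y \<noteq> 1"
      proof
        assume "d t y = 1"
        then have "t \<in> {s. d y s = 1 \<and> d x s = 1}" using True gdist_sym[of t y] by simp
        then show False using card_a[OF yx] a1 by auto
      qed
      then show ?thesis unfolding entry_LR[OF True y] by (simp add: algebra_simps)
    qed
  qed simp
  also have "\<dots> = (of_nat (b_num E 1) - of_nat (c_num E 2) + 1) * entry (L ** R ** R) w y +
    (of_nat (c_num E 2) - 1) * (\<Sum>t\<in>UNIV. entry (L ** R ** R) w t)"
    by (simp add: sum.distrib sum_distrib_left)
  finally show ?thesis .
qed

text \<open>The relation times \<open>R ** R\<close> on the right, and its transpose multiplied by
  \<open>L\<close> on the left and \<open>R\<close> on the right, agree in all terms but the first.
  The outer factors put the intermediate vertex on level 3, where the relation is assumed.\<close>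

lemma raise_lower_commute:
  assumes uniform: "\<And>v u. d x u = 3 \<Longrightarrow>
      e * entry (R ** L ** L) v u + entry (L ** R ** L) v u + g * entry (L ** L ** R) v u = f * entry L v u"
    and e: "e \<noteq> 0" and w: "d x w = 2" and y: "d x y = 1"
  shows "entry (R ** L ** L ** R ** R) w y = entry (L ** R ** R ** L ** R) w y"
proof -
  have 1: "e * entry (R ** L ** L ** (R ** R)) w y + entry (L ** R ** L ** (R ** R)) w y
      + g * entry (L ** L ** R ** (R ** R)) w y = f * entry (L ** (R ** R)) w y"
    by (rule linear_relation_mult_right) (use y in \<open>auto simp: entry_RR entry_LL intro!: uniform split: if_splits\<close>)
  have tr: "transpose (R ** L ** L) = R ** R ** L" "transpose (L ** R ** L) = R ** L ** R"
    "transpose (L ** L ** R) = L ** R ** R" "transpose L = R"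
    unfolding R_transpose by (simp_all add: matrix_transpose_mul matrix_mul_assoc)
  have tu: "e * entry (R ** R ** L) u v + entry (R ** L ** R) u v + g * entry (L ** R ** R) u v = f * entry R u v"
    if "d x u = 3" for u v
  proof -
    have "entry (R ** R ** L) u v = entry (R ** L ** L) v u" "entry (R ** L ** R) u v = entry (L ** R ** L) v u"
      "entry (L ** R ** R) u v = entry (L ** L ** R) v u"
      by (simp_all only: tr(1-3)[symmetric]) (simp_all add: transpose_def)
    then show ?thesis using uniform[OF that, of v] by (simp only: entry_R)
  qed
  have "e * entry (L ** (R ** R ** L)) w v + entry (L ** (R ** L ** R)) w v
      + g * entry (L ** (L ** R ** R)) w v = f * entry (L ** R) w v" for v
    by (rule linear_relation_mult_left) (use w in \<open>auto simp: entry_L intro!: tu split: if_splits\<close>)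
  then have 2: "e * entry (L ** (R ** R ** L) ** R) w y + entry (L ** (R ** L ** R) ** R) w y
      + g * entry (L ** (L ** R ** R) ** R) w y = f * entry (L ** R ** R) w y"
    by (rule linear_relation_mult_right)
  have "e * entry (R ** L ** L ** R ** R) w y = e * entry (L ** R ** R ** L ** R) w y"
    using trans[OF 1[unfolded matrix_mul_assoc] 2[unfolded matrix_mul_assoc, symmetric]]
    by (simp only: add_right_cancel)
  then show ?thesis using e by simp
qed

section \<open>Elimination of the parameters of a uniform structure\<close>

lemma not_uniform:
  assumes np: "\<not> near_polygon E"
  shows "\<not> supports_uniform_structure E x"
proof
  assume "supports_uniform_structure E x"
  then obtain e f where pm: "parameter_matrix D e"
    and u: "\<forall>i\<in>{1..D}. \<forall>v\<in>range (\<lambda>w. dual_idem E x i *v w).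
           e_minus e i *s ((R ** L ** L) *v v) + (L ** R ** L) *v v
             + e_plus D e i *s ((L ** L ** R) *v v) = f i *s (L *v v)"
    unfolding supports_uniform_structure_def admits_uniform_structure_def Let_def
      eccentricity_flattening[OF conn] lowering_matrix_flattening[OF conn]
      raising_matrix_flattening[OF conn] dual_idem_flattening[OF conn] eccentricity_eq diameter
    by blast
  have ue: "e_minus e i * entry (R ** L ** L) y w + entry (L ** R ** L) y w
      + e_plus D e i * entry (L ** L ** R) y w = f i * entry L y w" if "i \<in> {1..D}" "d x w = i" for i y w
    using uniform_entry[OF bspec[OF u that(1)] that(2)] .
  define C :: complex where "C = of_nat (c_num E 2)"
  have C0: "C \<noteq> 0" using c_pos[of 2] diameter diameter_ge by (simp add: C_def)
  \<comment> \<open>The level 2 relation at a nonadjacent pair, where the entry of \<open>L\<close>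
    on the right side is 0.\<close>
  have two: "e_minus e 2 * C + (C - of_nat (card {s. d x s = 1 \<and> d w s = 1 \<and> d y s = 1})) * (C - 1)
      + e_plus D e 2 * (C * of_nat (card {u. d w u = 1 \<and> d x u = 3 \<and> d y u = 2})) = 0"
    if y: "d x y = 1" and w: "d x w = 2" and yw: "d y w \<noteq> 1" for y w
    using ue[of 2 w y] diameter_ge w yw
    unfolding entry_RLL[OF y] entry_LRL[OF y w yw] entry_LLR[OF y w] by (simp add: entry_L C_def)
  obtain w where w: "d x w = 2" using ex_gdist[of 2 x] diameter diameter_ge by auto
  obtain y2 where y2: "d x y2 = 1" "d y2 w = 2" "card {s. d x s = 1 \<and> d w s = 1 \<and> d y2 s = 1} = 0"
    using ex_no_common_neighbour[OF np w] .
  \<comment> \<open>At distance 2 the raising count is 0, so \<open>e_plus\<close> drops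
    out.\<close>
  have "e_minus e 2 * C + C * (C - 1) = 0"
    using two[OF y2(1) w] y2(2) unfolding y2(3) card_raise_2[OF y2(1) w y2(2)] by simp
  then have "C * (e_minus e 2 + C - 1) = 0" by (simp add: algebra_simps)
  then have "e_minus e 2 + C - 1 = 0" using C0 by (simp only: mult_eq_0_iff simp_thms)
  then have em: "e_minus e 2 = 1 - C" by (simp add: algebra_simps)
  \<comment> \<open>At distance 3 the first two terms are as for \<open>y2\<close>, but the raising
    count is nonzero; this isolates \<open>e_plus\<close>.\<close>
  obtain y3 where y3: "d x y3 = 1" "d w y3 = 3"
    using ex_raise[of x w 2] w diameter diameter_ge by auto
  have y3w: "d y3 w = 3" using y3 gdist_sym[of w y3] by simp
  have none: "{s. d x s = 1 \<and> d w s = 1 \<and> d y3 s = 1} = {}"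
  proof -
    have False if "d w s = 1" "d y3 s = 1" for s
      using gdist_triangle[of w y3 s] gdist_sym[of s y3] that y3 by linarith
    then show ?thesis by auto
  qed
  have m: "(of_nat (c_num E 3 - c_num E 2) :: complex) \<noteq> 0" using c2_less_c3 by simp
  have "e_minus e 2 * C + C * (C - 1) + e_plus D e 2 * (C * of_nat (c_num E 3 - c_num E 2)) = 0"
    using two[OF y3(1) w] y3w unfolding card_raise_3[OF y3(1) w y3w] none by simp
  then have "e_plus D e 2 * (C * of_nat (c_num E 3 - c_num E 2)) = 0"
    unfolding em by (simp add: algebra_simps)
  then have ep: "e_plus D e 2 = 0" using C0 m by simp
  \<comment> \<open>Because \<open>D \<ge> 3\<close>, \<open>e_plus D e 2\<close> is the actual
    entry \<open>e 2 3\<close>. Its vanishing rules out a zero-free superdiagonal, so the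
    subdiagonal must be zero-free.\<close>
  have em_nz: "e_minus e i \<noteq> 0" if "i \<in> {2..D}" for i
  proof -
    have "e (3 - 1) 3 = 0" if "D \<noteq> 2"
      using ep that by (simp add: e_plus_def)
    then have "\<not> (\<forall>i\<in>{2..D}. e (i - 1) i \<noteq> 0)"
      using diameter_ge by (intro notI) (auto dest!: bspec[of _ _ 3])
    then show ?thesis using pm that unfolding parameter_matrix_def e_minus_def by auto
  qed
  have C1: "C \<noteq> 1" using em_nz[of 2] em diameter_ge by auto
  have a1: "a_num E 1 = 0"
  proof (rule ccontr)
    assume "a_num E 1 \<noteq> 0"
    then obtain y1 where y1: "d x y1 = 1" "d y1 w = 2" "card {s. d x s = 1 \<and> d w s = 1 \<and> d y1 s = 1} = 1"
      using ex_common_neighbour[of x w] w by auto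
    have "e_minus e 2 * C + (C - 1) * (C - 1) = 0"
      using two[OF y1(1) w] y1(2) unfolding y1(3) card_raise_2[OF y1(1) w y1(2)] by simp
    then have "C = 1" unfolding em by (simp add: algebra_simps)
    then show False using C1 by simp
  qed
  have comm: "entry (R ** L ** L ** R ** R) w y = entry (L ** R ** R ** L ** R) w y" if "d x y = 1" for y
    by (rule raise_lower_commute[OF ue[of 3] em_nz[of 3] w that]) (use diameter_ge in auto)
  \<comment> \<open>Neither \<open>y2\<close> nor \<open>y3\<close> is adjacent to \<open>w\<close>,
    so \<open>RLLRR_entry\<close> gives both the same value; \<open>LRRLR_entry\<close> then equates
    entries of \<open>L ** R ** R\<close> that are zero at \<open>y2\<close> and nonzero at
    \<open>y3\<close>.\<close>
  have "entry (L ** R ** R ** L ** R) w y2 = entry (L ** R ** R ** L ** R) w y3"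
    using y2 y3 gdist_sym[of w y2]
    by (simp only: comm[symmetric]) (simp add: RLLRR_entry[OF a1 w])
  then have "(of_nat (b_num E 1) - of_nat (c_num E 2) + 1) * entry (L ** R ** R) w y2 =
      (of_nat (b_num E 1) - of_nat (c_num E 2) + 1) * entry (L ** R ** R) w y3"
    unfolding LRRLR_entry[OF a1 w y2(1)] LRRLR_entry[OF a1 w y3(1)] by simp
  moreover have "(of_nat (b_num E 1) - of_nat (c_num E 2) + 1 :: complex) \<noteq> 0"
  proof -
    have "(of_nat (b_num E 1) - of_nat (c_num E 2) + 1 :: complex) = of_nat (b_num E 1 - c_num E 2 + 1)"
      using c2_le_b1[OF a1] by (simp add: of_nat_diff)
    then show ?thesis by (metis of_nat_eq_0_iff add_is_0 one_neq_zero)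
  qed
  moreover have "entry (L ** R ** R) w y2 = 0"
    unfolding entry_LRR[OF w] card_raise_2[OF y2(1) w y2(2)] by simp
  moreover have "entry (L ** R ** R) w y3 \<noteq> 0"
    unfolding entry_LRR[OF w] card_raise_3[OF y3(1) w y3w] using y3 C0 m by (simp add: C_def)
  ultimately show False by simp
qed

end

theorem theorem7p3:
  fixes E :: "('v::finite \<times> 'v) set" and D :: nat and q \<alpha> \<beta> :: real and x :: 'v
  assumes "distance_regular E"
    and "\<not> bipartite E"
    and "gdiameter E = D"
    and "D \<ge> 3"
    and "has_classical_parameters E D q \<alpha> \<beta>"
    and "q < -1"
    and "\<not> near_polygon E"
  shows "\<not> supports_uniform_structure E x"
proof -
  interpret rooted_classical E D q \<alpha> \<beta> x
    by unfold_locales (use assms in auto)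
  show ?thesis using assms(7) by (rule not_uniform)
qed

end
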